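(* Consider the $2$-dimensional commutative pre-Lie algebras $C_{01},\dots,C_{04}$, $C_{05}^{\alpha}$, $C_{06}^{\alpha}$, $C_{07}$, $C_{08}$, $C_{09}$, $C_{10}^{\alpha}$, $C_{11}$, $C_{12}^{\alpha}$, $C_{13}$, $C_{14}$, $C_{15}^{\gamma}$, $C_{16}$, $C_{17}^{\beta}$ (all parameters in $\mathbb C$) and the zero algebra $\mathbb C^8$ (both products zero), as defined in the context. Their orbits have the following dimensions: $4$ for $C_{07},C_{08},C_{09},C_{11},C_{13},C_{14},C_{15}^{\gamma},C_{16}$; $3$ for $C_{01},C_{02},C_{04}$, $C_{05}^{\alpha}$ with $\alpha\neq1$, $C_{06}^{\alpha}$ with $\alpha\neq0$, $C_{10}^{\alpha}$, $C_{12}^{\alpha}$; $2$ for $C_{03}$, $C_{05}^{1}$, $C_{06}^{0}$, $C_{17}^{\beta}$; $0$ for $\mathbb C^8$. For two algebras $T,T'$ of this list one has $T\to T'$ if and only if $T\cong T'$ or $T'$ can be reached from $T$ by a chain of the following degenerations (valid for all parameter values subject to the indicated restrictions): $C_{07}\to C_{05}^{0}$; $C_{07}\to C_{06}^{1}$; $C_{08}\to C_{05}^{1/2}$; $C_{08}\to C_{06}^{2}$; $C_{09}\to C_{10}^{0}$; $C_{09}\to C_{12}^{0}$; $C_{11}\to C_{05}^{0}$; $C_{11}\to C_{10}^{0}$; $C_{11}\to C_{17}^{\beta}$ for every $\beta$; $C_{13}\to C_{05}^{0}$; $C_{13}\to C_{12}^{0}$; $C_{13}\to C_{17}^{\beta}$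 for every $\beta$; $C_{14}\to C_{05}^{2}$; $C_{14}\to C_{17}^{\beta}$ for every $\beta$; $C_{15}^{\gamma}\to C_{05}^{1/2}$; $C_{15}^{\gamma}\to C_{17}^{\beta}$ for every $\beta$; $C_{16}\to C_{06}^{2}$; $C_{16}\to C_{17}^{\beta}$ for every $\beta$; $C_{10}^{\alpha}\to C_{17}^{\alpha}$; $C_{12}^{\alpha}\to C_{17}^{-\alpha}$; $C_{01}\to C_{06}^{0}$; $C_{01}\to C_{03}$; $C_{02}\to C_{05}^{1}$; $C_{02}\to C_{03}$; $C_{04}\to C_{03}$; $C_{05}^{\alpha}\to C_{03}$ if $\alpha\ne1$; $C_{06}^{\alpha}\to C_{03}$ if $\alpha\neq0$; $C_{17}^{\beta}\to\mathbb C^8$; $C_{06}^{0}\to\mathbb C^8$; $C_{05}^{1}\to\mathbb C^8$; $C_{03}\to\mathbb C^8$.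
   Context: A commutative pre-Lie algebra is a complex vector space with a commutative associative product $\cdot$ and a pre-Lie product $\circ$, i.e. a bilinear product with $(x\circ y)\circ z-(y\circ x)\circ z=x\circ(y\circ z)-y\circ(x\circ z)$, such that $x\circ(y\cdot z)=(x\circ y)\cdot z+y\cdot(x\circ z)$. Fix a $2$-dimensional complex vector space $V$ with basis $e_1,e_2$. A $2$-dimensional such algebra is viewed as a pair $(\mu,\mu')\in \mathrm{Bil}(V\times V,V)^2\cong\mathbb C^{16}$ ($\mu$ is $\cdot$, $\mu'$ is $\circ$). $\mathrm{GL}(V)$ acts by $(g*(\mu,\mu'))(x,y)=(g\mu(g^{-1}x,g^{-1}y),\,g\mu'(g^{-1}x,g^{-1}y))$; $O(T)$ is the orbit of a structure representing $T$. We write $T\to T'$ ($T$ degenerates to $T'$) if a structure representing $T'$ lies in the Zariski closure $\overline{O(T)}$. The algebras are (unlisted products are zero, $\cdot$ is commutative; $C_{01}$--$C_{08}$ have $\cdot=0$): $C_{01}: e_1\circ e_1=e_1+e_2,\ e_2\circ e_1=e_2$; $C_{02}: e_1\circ e_1=e_1+e_2,\ e_1\circ e_2=e_2$; $C_{03}: e_1\circ e_1=e_2$; $C_{04}: e_2\circ e_1=e_1$; $C_{05}^{\alpha}: e_1\circ e_1=e_1,\ e_1\circ e_2=\alpha e_2$; $C_{06}^{\alpha}: e_1\circ e_1=e_1,\ e_1\circ e_2=\alpha e_2,\ e_2\circ e_1=e_2$; $C_{07}: e_1\circ e_1=e_1,\ e_2\circ e_2=e_2$; $C_{08}: e_1\circ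 e_1=e_1,\ e_1\circ e_2=2e_2,\ e_2\circ e_1=\frac12 e_1+e_2,\ e_2\circ e_2=e_2$; $C_{09}: e_1\cdot e_1=e_1,\ e_2\cdot e_2=e_2$; $C_{10}^{\alpha}: e_1\cdot e_1=e_1,\ e_1\cdot e_2=e_2,\ e_1\circ e_2=\alpha e_2$; $C_{11}: e_1\cdot e_1=e_1,\ e_1\cdot e_2=e_2,\ e_2\circ e_2=e_2$; $C_{12}^{\alpha}: e_1\cdot e_1=e_1,\ e_1\circ e_2=\alpha e_2$; $C_{13}: e_1\cdot e_1=e_1,\ e_2\circ e_2=e_2$; $C_{14}: e_1\cdot e_1=e_2,\ e_1\circ e_1=e_1,\ e_1\circ e_2=2e_2$; $C_{15}^{\alpha}: e_1\cdot e_1=e_2,\ e_1\circ e_1=\alpha e_1,\ e_1\circ e_2=2\alpha e_2,\ e_2\circ e_1=e_1+\alpha e_2,\ e_2\circ e_2=2e_2$; $C_{16}: e_1\cdot e_1=e_2,\ e_1\circ e_1=e_1,\ e_1\circ e_2=2e_2,\ e_2\circ e_1=e_2$; $C_{17}^{\alpha}: e_1\cdot e_1=e_2,\ e_1\circ e_1=\alpha e_2$. *)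

theory Defs
  imports "HOL-Analysis.Analysis" "HOL-Library.Extended_Nat"
begin

section \<open>Pairs of bilinear products on a two-dimensional complex vector space\<close>

type_synonym V = "complex ^ 2"
type_synonym product = "V \<Rightarrow> V \<Rightarrow> V"

text \<open>The first component of a pair is the commutative product, the second one the
  pre-Lie product.\<close>
type_synonym bilpair = "product \<times> product"

abbreviation e1 :: V where "e1 \<equiv> axis 1 1"
abbreviation e2 :: V where "e2 \<equiv> axis 2 1"

definition clinear :: "(V \<Rightarrow> V) \<Rightarrow> bool" where
  "clinear f \<longleftrightarrow> Vector_Spaces.linear (*s) (*s) f"

definition cbilinear :: "product \<Rightarrow> bool" where
  "cbilinear m \<longleftrightarrow> (\<forall>x. clinear (\<lambda>y. m x y)) \<and> (\<forall>y. clinear (\<lambda>x. m x y))"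

definition Bil2 :: "bilpair set" where
  "Bil2 = {T. cbilinear (fst T) \<and> cbilinear (snd T)}"

definition comm_pre_lie :: "bilpair \<Rightarrow> bool" where
  "comm_pre_lie T \<longleftrightarrow> (case T of (m, p) \<Rightarrow>
     cbilinear m \<and> cbilinear p \<and>
     (\<forall>x y. m x y = m y x) \<and>
     (\<forall>x y z. m (m x y) z = m x (m y z)) \<and>
     (\<forall>x y z. p (p x y) z - p (p y x) z = p x (p y z) - p y (p x z)) \<and>
     (\<forall>x y z. p x (m y z) = m (p x y) z + m y (p x z)))"

definition GL :: "(V \<Rightarrow> V) set" where
  "GL = {g. clinear g \<and> bij g}"

definition act :: "(V \<Rightarrow> V) \<Rightarrow> bilpair \<Rightarrow> bilpair" where
  "act g T = ((\<lambda>x y. g (fst T (inv g x) (inv g y))), (\<lambda>x y. g (snd T (inv g x) (inv g y))))"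

definition orbit :: "bilpair \<Rightarrow> bilpair set" where
  "orbit T = (\<lambda>g. act g T) ` GL"

definition isomorphic :: "bilpair \<Rightarrow> bilpair \<Rightarrow> bool" where
  "isomorphic T T' \<longleftrightarrow> (\<exists>g. clinear g \<and> bij g \<and>
     (\<forall>x y. g (fst T x y) = fst T' (g x) (g y)) \<and>
     (\<forall>x y. g (snd T x y) = snd T' (g x) (g y)))"


section \<open>The Zariski topology\<close>

text \<open>Polynomials in the 16 structure constants, i.e. in the coordinates of the space of
  pairs of bilinear maps with respect to the basis \<open>e1, e2\<close>.\<close>
inductive polyfun :: "(bilpair \<Rightarrow> complex) \<Rightarrow> bool" where
  const: "polyfun (\<lambda>_. c)"
| coord1: "polyfun (\<lambda>T. fst T (axis i 1) (axis j 1) $ k)"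
| coord2: "polyfun (\<lambda>T. snd T (axis i 1) (axis j 1) $ k)"
| add: "polyfun f \<Longrightarrow> polyfun g \<Longrightarrow> polyfun (\<lambda>T. f T + g T)"
| mult: "polyfun f \<Longrightarrow> polyfun g \<Longrightarrow> polyfun (\<lambda>T. f T * g T)"

definition zero_locus :: "(bilpair \<Rightarrow> complex) set \<Rightarrow> bilpair set" where
  "zero_locus F = {T \<in> Bil2. \<forall>f\<in>F. f T = 0}"

definition zariski :: "bilpair topology" where
  "zariski = topology (\<lambda>U. \<exists>F. (\<forall>f\<in>F. polyfun f) \<and> U = Bil2 - zero_locus F)"

lemma istopology_zariski:
  "istopology (\<lambda>U. \<exists>F. (\<forall>f\<in>F. polyfun f) \<and> U = Bil2 - zero_locus F)"
  unfolding istopology_def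
proof (intro conjI allI impI)
  fix S T
  assume "\<exists>F. (\<forall>f\<in>F. polyfun f) \<and> S = Bil2 - zero_locus F"
    and "\<exists>F. (\<forall>f\<in>F. polyfun f) \<and> T = Bil2 - zero_locus F"
  then obtain F G where F: "\<forall>f\<in>F. polyfun f" "S = Bil2 - zero_locus F"
    and G: "\<forall>f\<in>G. polyfun f" "T = Bil2 - zero_locus G" by blast
  let ?H = "{\<lambda>x. f x * g x | f g. f \<in> F \<and> g \<in> G}"
  have "\<forall>h\<in>?H. polyfun h" using F G by (auto intro: polyfun.mult)
  moreover have "S \<inter> T = Bil2 - zero_locus ?H"
    unfolding F(2) G(2) zero_locus_def by fastforce
  ultimately show "\<exists>F. (\<forall>f\<in>F. polyfun f) \<and> S \<inter> T = Bil2 - zero_locus F" by blast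
next
  fix K
  assume "\<forall>U\<in>K. \<exists>F. (\<forall>f\<in>F. polyfun f) \<and> U = Bil2 - zero_locus F"
  then obtain F where F: "\<And>U. U \<in> K \<Longrightarrow> (\<forall>f\<in>F U. polyfun f) \<and> U = Bil2 - zero_locus (F U)"
    by metis
  have "\<Union>K = (\<Union>U\<in>K. Bil2 - zero_locus (F U))" using F by auto
  also have "\<dots> = Bil2 - zero_locus (\<Union>(F ` K))" by (auto simp: zero_locus_def)
  finally show "\<exists>F. (\<forall>f\<in>F. polyfun f) \<and> \<Union>K = Bil2 - zero_locus F"
    using F by (intro exI[of _ "\<Union>(F ` K)"]) auto
qed

lemma openin_zariski:
  "openin zariski U \<longleftrightarrow> (\<exists>F. (\<forall>f\<in>F. polyfun f) \<and> U = Bil2 - zero_locus F)"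
  unfolding zariski_def by (simp add: topology_inverse'[OF istopology_zariski])

lemma topspace_zariski: "topspace zariski = Bil2"
proof -
  have "openin zariski Bil2"
    unfolding openin_zariski
    by (intro exI[of _ "{\<lambda>_. 1}"]) (auto simp: zero_locus_def intro: polyfun.const)
  then show ?thesis
    by (auto simp: topspace_def openin_zariski)
qed

lemma closedin_zariski:
  "closedin zariski Z \<longleftrightarrow> (\<exists>F. (\<forall>f\<in>F. polyfun f) \<and> Z = zero_locus F)"
proof -
  have sub: "Bil2 - (Bil2 - zero_locus F) = zero_locus F" for F by (auto simp: zero_locus_def)
  have "zero_locus F \<subseteq> Bil2" for F by (auto simp: zero_locus_def)
  moreover have "Z = Bil2 - (Bil2 - Z)" if "Z \<subseteq> Bil2" using that by blast
  ultimately show ?thesis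
    unfolding closedin_def topspace_zariski openin_zariski using sub by metis
qed

definition degenerates :: "bilpair \<Rightarrow> bilpair \<Rightarrow> bool" where
  "degenerates T T' \<longleftrightarrow> (\<exists>S\<in>orbit T'. S \<in> zariski closure_of orbit T)"


section \<open>Dimension\<close>

definition irreducible_in :: "'a topology \<Rightarrow> 'a set \<Rightarrow> bool" where
  "irreducible_in X Z \<longleftrightarrow> Z \<subseteq> topspace X \<and> Z \<noteq> {} \<and>
     (\<forall>A B. closedin X A \<and> closedin X B \<and> Z \<subseteq> A \<union> B \<longrightarrow> Z \<subseteq> A \<or> Z \<subseteq> B)"

text \<open>The Krull dimension of a (nonempty) topological space: the supremum of the lengths \<open>n\<close> of
  strictly increasing chains \<open>Z 0 \<subset> \<dots> \<subset> Z n\<close> of irreducible closed subsets.\<close>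
definition krull_dim :: "'a topology \<Rightarrow> enat" where
  "krull_dim X = Sup {enat n | n. \<exists>Z :: nat \<Rightarrow> 'a set.
     (\<forall>i\<le>n. closedin X (Z i) \<and> irreducible_in X (Z i)) \<and> (\<forall>i<n. Z i \<subset> Z (Suc i))}"

definition orbit_dim :: "bilpair \<Rightarrow> enat" where
  "orbit_dim T = krull_dim (subtopology zariski (orbit T))"


section \<open>The list of algebras\<close>

text \<open>\<open>bil a b c d\<close> is the bilinear product with
  \<open>e1 e1 = a\<close>, \<open>e1 e2 = b\<close>, \<open>e2 e1 = c\<close>, \<open>e2 e2 = d\<close>.\<close>
definition bil :: "V \<Rightarrow> V \<Rightarrow> V \<Rightarrow> V \<Rightarrow> product" where
  "bil a b c d = (\<lambda>x y. (x $ 1 * y $ 1) *s a + (x $ 1 * y $ 2) *s b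
                      + (x $ 2 * y $ 1) *s c + (x $ 2 * y $ 2) *s d)"

datatype alg =
    C01 | C02 | C03 | C04 | C05 complex | C06 complex | C07 | C08 | C09
  | C10 complex | C11 | C12 complex | C13 | C14 | C15 complex | C16 | C17 complex
  | Zero

fun str :: "alg \<Rightarrow> bilpair" where
  "str C01 = (bil 0 0 0 0, bil (e1 + e2) 0 e2 0)"
| "str C02 = (bil 0 0 0 0, bil (e1 + e2) e2 0 0)"
| "str C03 = (bil 0 0 0 0, bil e2 0 0 0)"
| "str C04 = (bil 0 0 0 0, bil 0 0 e1 0)"
| "str (C05 \<alpha>) = (bil 0 0 0 0, bil e1 (\<alpha> *s e2) 0 0)"
| "str (C06 \<alpha>) = (bil 0 0 0 0, bil e1 (\<alpha> *s e2) e2 0)"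
| "str C07 = (bil 0 0 0 0, bil e1 0 0 e2)"
| "str C08 = (bil 0 0 0 0, bil e1 (2 *s e2) ((1/2) *s e1 + e2) e2)"
| "str C09 = (bil e1 0 0 e2, bil 0 0 0 0)"
| "str (C10 \<alpha>) = (bil e1 e2 e2 0, bil 0 (\<alpha> *s e2) 0 0)"
| "str C11 = (bil e1 e2 e2 0, bil 0 0 0 e2)"
| "str (C12 \<alpha>) = (bil e1 0 0 0, bil 0 (\<alpha> *s e2) 0 0)"
| "str C13 = (bil e1 0 0 0, bil 0 0 0 e2)"
| "str C14 = (bil e2 0 0 0, bil e1 (2 *s e2) 0 0)"
| "str (C15 \<alpha>) = (bil e2 0 0 0, bil (\<alpha> *s e1) ((2 * \<alpha>) *s e2) (e1 + \<alpha> *s e2) (2 *s e2))"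
| "str C16 = (bil e2 0 0 0, bil e1 (2 *s e2) e2 0)"
| "str (C17 \<alpha>) = (bil e2 0 0 0, bil (\<alpha> *s e2) 0 0 0)"
| "str Zero = (bil 0 0 0 0, bil 0 0 0 0)"

lemma bil_basis:
  "bil a b c d e1 e1 = a" "bil a b c d e1 e2 = b"
  "bil a b c d e2 e1 = c" "bil a b c d e2 e2 = d"
  by (simp_all add: bil_def axis_def)

lemma cbilinear_bil: "cbilinear (bil a b c d)"
  unfolding cbilinear_def clinear_def bil_def
  by (auto simp: Vector_Spaces.linear_iff vec.vector_space_axioms vec_eq_iff algebra_simps)

lemma bil_nth:
  "bil a b c d x y $ i = x $ 1 * y $ 1 * a $ i + x $ 1 * y $ 2 * b $ i
                       + x $ 2 * y $ 1 * c $ i + x $ 2 * y $ 2 * d $ i"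
  by (simp add: bil_def)

lemma e_nth: "e1 $ 1 = 1" "e1 $ 2 = 0" "e2 $ 1 = 0" "e2 $ 2 = 1"
  by (simp_all add: axis_def)

lemma comm_pre_lie_str: "comm_pre_lie (str T)"
proof -
  note simps = comm_pre_lie_def cbilinear_bil vec_eq_iff forall_2 bil_nth e_nth
  show ?thesis
  proof (cases T)
    case C08 show ?thesis unfolding C08 by (simp add: simps) (simp add: field_simps)
  next
    case (C15 a) show ?thesis unfolding C15 by (simp add: simps; intro conjI allI; algebra)
  qed ((simp add: simps; intro conjI allI; simp add: algebra_simps)+)
qed

text \<open>The primary degenerations, as a relation on the list.\<close>
inductive primary :: "alg \<Rightarrow> alg \<Rightarrow> bool" where
  "primary C07 (C05 0)"
| "primary C07 (C06 1)"
| "primary C08 (C05 (1/2))"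
| "primary C08 (C06 2)"
| "primary C09 (C10 0)"
| "primary C09 (C12 0)"
| "primary C11 (C05 0)"
| "primary C11 (C10 0)"
| "primary C11 (C17 \<beta>)"
| "primary C13 (C05 0)"
| "primary C13 (C12 0)"
| "primary C13 (C17 \<beta>)"
| "primary C14 (C05 2)"
| "primary C14 (C17 \<beta>)"
| "primary (C15 \<gamma>) (C05 (1/2))"
| "primary (C15 \<gamma>) (C17 \<beta>)"
| "primary C16 (C06 2)"
| "primary C16 (C17 \<beta>)"
| "primary (C10 \<alpha>) (C17 \<alpha>)"
| "primary (C12 \<alpha>) (C17 (- \<alpha>))"
| "primary C01 (C06 0)"
| "primary C01 C03"
| "primary C02 (C05 1)"
| "primary C02 C03"
| "primary C04 C03"
| "\<alpha> \<noteq> 1 \<Longrightarrow> primary (C05 \<alpha>) C03"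
| "\<alpha> \<noteq> 0 \<Longrightarrow> primary (C06 \<alpha>) C03"
| "primary (C17 \<beta>) Zero"
| "primary (C06 0) Zero"
| "primary (C05 1) Zero"
| "primary C03 Zero"

end

theory Submission
  imports Defs "HOL-Library.Function_Algebras"
begin

text \<open>Degenerations are limits along curves: a one-parameter family of bases in which the structure
  constants of \<open>T\<close> tend to those of \<open>T'\<close>. Non-degenerations come from identities between the two
  products and the trace forms of their multiplication operators, which are invariant under the
  group and closed. For the dimensions, a chain of \<open>n + 1\<close> irreducible closed sets yields \<open>n\<close>
  algebraically independent functions on the orbit, and counting monomials in the entries of a
  matrix modulo the stabiliser bounds \<open>n\<close>; conversely, a flag of affine families of matrices, with
  a function separating each step, gives a chain of the required length.\<close>

text \<open>Non-degeneration only has to exclude other members of the list, so at most three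
  identities per algebra suffice. Most compare the left and right traces of the second product, or
  \<open>trR (x \<circ> y)\<close> with \<open>trR x * trR y\<close>; these ratios pin down the
  parameter of a family. Isomorphism stands beside reachability in the result because
  \<open>C15 \<gamma>\<close> and \<open>C15 (- \<gamma>)\<close> are distinct entries with the same
  orbit. The Krull dimension is that of the orbit with its relative topology, and both bounds are
  moved to the four entries of a matrix. The stabiliser of \<open>T\<close> acts by multiplication
  from the right without changing the point of the orbit. On a dense set of matrices it can set one
  or two entries to 1, and the entries that remain free give the exponent in the count. For the
  lower bound the flag has to be adapted to \<open>T\<close>: the representative is chosen so that a
  trace form vanishes on \<open>e2\<close>, and the line of \<open>e2\<close> then determines the
  flag. For \<open>C03\<close> and \<open>C17 \<beta>\<close> all trace forms vanish, and structure
  constants take their place.\<close>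

section \<open>Matrices as pairs of columns, and isomorphism of structures\<close>

definition lin :: "V \<Rightarrow> V \<Rightarrow> V \<Rightarrow> V" where
  "lin u v x = x $ 1 *s u + x $ 2 *s v"

definition det2 :: "V \<Rightarrow> V \<Rightarrow> complex" where
  "det2 u v = u $ 1 * v $ 2 - u $ 2 * v $ 1"

text \<open>The adjugate matrix. The inverse \<open>linv\<close> is split into adjugate and
  determinant so that denominators on the orbit can be cleared by powers of the determinant.\<close>

definition adj :: "V \<Rightarrow> V \<Rightarrow> V \<Rightarrow> V" where
  "adj u v x = (v $ 2 * x $ 1 - v $ 1 * x $ 2) *s e1 + (u $ 1 * x $ 2 - u $ 2 * x $ 1) *s e2"

definition linv :: "V \<Rightarrow> V \<Rightarrow> V \<Rightarrow> V" where
  "linv u v x = (1 / det2 u v) *s adj u v x"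

lemma V_eq_iff: "(x::V) = y \<longleftrightarrow> x $ 1 = y $ 1 \<and> x $ 2 = y $ 2"
  by (simp add: vec_eq_iff forall_2)

lemma V_expand: "(x::V) = x $ 1 *s e1 + x $ 2 *s e2"
  by (simp add: V_eq_iff e_nth)

lemma lin_nth: "lin u v x $ i = x $ 1 * u $ i + x $ 2 * v $ i"
  by (simp add: lin_def)

lemma adj_nth:
  "adj u v x $ 1 = v $ 2 * x $ 1 - v $ 1 * x $ 2"
  "adj u v x $ 2 = u $ 1 * x $ 2 - u $ 2 * x $ 1"
  by (simp_all add: adj_def e_nth)

lemma linv_nth: "linv u v x $ i = adj u v x $ i / det2 u v"
  by (simp add: linv_def)

lemma lin_basis [simp]: "lin u v e1 = u" "lin u v e2 = v"
  by (simp_all add: V_eq_iff lin_nth e_nth)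

lemma lin_e [simp]: "lin e1 e2 x = x"
  by (simp add: V_eq_iff lin_nth e_nth)

lemma lin_linv [simp]: "det2 u v \<noteq> 0 \<Longrightarrow> lin u v (linv u v x) = x"
  by (simp add: V_eq_iff lin_nth linv_nth adj_nth divide_simps)
     (simp add: det2_def algebra_simps)

lemma linv_lin [simp]: "det2 u v \<noteq> 0 \<Longrightarrow> linv u v (lin u v x) = x"
  by (simp add: V_eq_iff lin_nth linv_nth adj_nth divide_simps)
     (simp add: det2_def algebra_simps)

lemma clinear_alt:
  "clinear f \<longleftrightarrow> (\<forall>x y. f (x + y) = f x + f y) \<and> (\<forall>c x. f (c *s x) = c *s f x)"
  by (auto simp: clinear_def Vector_Spaces.linear_iff vec.vector_space_axioms)

lemma clinear_lin [simp]: "clinear (lin u v)"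
  by (simp add: clinear_alt V_eq_iff lin_nth algebra_simps)

lemma clinear_eq_lin: "clinear f \<Longrightarrow> f = lin (f e1) (f e2)"
proof
  fix x assume "clinear f"
  then have "f (x $ 1 *s e1 + x $ 2 *s e2) = lin (f e1) (f e2) x"
    by (simp add: clinear_alt lin_def)
  then show "f x = lin (f e1) (f e2) x" by (simp flip: V_expand)
qed

lemma bij_lin: "bij (lin u v) \<longleftrightarrow> det2 u v \<noteq> 0"
proof
  assume "det2 u v \<noteq> 0"
  then show "bij (lin u v)"
    by (intro bij_betw_byWitness[where f' = "linv u v"]) auto
next
  assume bij: "bij (lin u v)"
  show "det2 u v \<noteq> 0"
  proof
    assume d: "det2 u v = 0"
    have ker: "x = 0" if "lin u v x = 0" for x
    proof -
      have "lin u v 0 = 0" by (simp add: lin_def)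
      with that bij show ?thesis by (metis bij_is_inj injD)
    qed
    \<comment> \<open>The entries of v_i u - u_i v are 0 and, up to sign, the determinant.\<close>
    have "lin u v (v $ i *s e1 - u $ i *s e2) = 0" for i
      using d exhaust_2[of i] by (auto simp: V_eq_iff lin_nth e_nth det2_def algebra_simps)
    then have z: "v $ i *s e1 - u $ i *s e2 = 0" for i using ker by blast
    have "v $ i = 0 \<and> u $ i = 0" for i
      using z[of i] by (simp add: V_eq_iff e_nth)
    then have "lin u v e1 = 0" by (simp add: V_eq_iff lin_nth)
    then have "e1 = (0::V)" by (rule ker)
    then show False by (simp add: V_eq_iff e_nth)
  qed
qed

lemma inv_lin: "det2 u v \<noteq> 0 \<Longrightarrow> inv (lin u v) = linv u v"
  by (rule inv_equality) auto

lemma GL_eq: "GL = {lin u v | u v. det2 u v \<noteq> 0}"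
  unfolding GL_def using clinear_eq_lin bij_lin by (auto; metis)

lemma linv_eq_lin: "linv u v = lin (linv u v e1) (linv u v e2)"
  by (rule ext) (simp add: V_eq_iff lin_nth linv_nth adj_nth e_nth diff_divide_distrib mult.commute)

lemma clinear_linv [simp]: "clinear (linv u v)"
  by (subst linv_eq_lin) simp

lemma clinear_comp: "clinear f \<Longrightarrow> clinear g \<Longrightarrow> clinear (\<lambda>x. f (g x))"
  by (simp add: clinear_alt)

lemma act_lin:
  "det2 u v \<noteq> 0 \<Longrightarrow> act (lin u v) T =
    (\<lambda>x y. lin u v (fst T (linv u v x) (linv u v y)), \<lambda>x y. lin u v (snd T (linv u v x) (linv u v y)))"
  by (simp add: act_def inv_lin)

lemma isomorphic_lin:
  "isomorphic T S \<longleftrightarrow> (\<exists>u v. det2 u v \<noteq> 0 \<and>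
     (\<forall>x y. lin u v (fst T x y) = fst S (lin u v x) (lin u v y)) \<and>
     (\<forall>x y. lin u v (snd T x y) = snd S (lin u v x) (lin u v y)))"
  unfolding isomorphic_def using clinear_eq_lin bij_lin by (metis clinear_lin)

lemma act_lin_eq_iff:
  assumes "det2 u v \<noteq> 0"
  shows "act (lin u v) T = S \<longleftrightarrow>
     (\<forall>x y. lin u v (fst T x y) = fst S (lin u v x) (lin u v y)) \<and>
     (\<forall>x y. lin u v (snd T x y) = snd S (lin u v x) (lin u v y))"
    (is "_ \<longleftrightarrow> ?R")
proof
  assume "act (lin u v) T = S"
  then show ?R using assms by (auto simp: act_lin)
next
  assume ?R
  then have "fst (act (lin u v) T) = fst S" "snd (act (lin u v) T) = snd S"
    using assms by (auto simp: act_lin fun_eq_iff)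
  then show "act (lin u v) T = S" by (simp add: prod_eq_iff)
qed

lemma orbit_iff_lin: "S \<in> orbit T \<longleftrightarrow> (\<exists>u v. det2 u v \<noteq> 0 \<and> act (lin u v) T = S)"
  unfolding orbit_def GL_eq by auto

lemma orbit_iff_isomorphic: "S \<in> orbit T \<longleftrightarrow> isomorphic T S"
  unfolding orbit_iff_lin isomorphic_lin by (metis act_lin_eq_iff)

lemma isomorphic_refl: "isomorphic T T"
  unfolding isomorphic_lin by (intro exI[of _ e1] exI[of _ e2]) (simp add: det2_def e_nth)

lemma isomorphic_trans:
  assumes "isomorphic A B" "isomorphic B C" shows "isomorphic A C"
proof -
  obtain f g where f: "clinear f" "bij f" "\<forall>x y. f (fst A x y) = fst B (f x) (f y)"
      "\<forall>x y. f (snd A x y) = snd B (f x) (f y)"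
    and g: "clinear g" "bij g" "\<forall>x y. g (fst B x y) = fst C (g x) (g y)"
      "\<forall>x y. g (snd B x y) = snd C (g x) (g y)"
    using assms unfolding isomorphic_def by blast
  then show ?thesis unfolding isomorphic_def
    by (intro exI[of _ "\<lambda>x. g (f x)"]) (use bij_comp[OF f(2) g(2)] in \<open>auto simp: clinear_comp o_def\<close>)
qed

lemma isomorphic_sym:
  assumes "isomorphic A B" shows "isomorphic B A"
proof -
  obtain u v where d: "det2 u v \<noteq> 0"
     and h: "\<And>x y. lin u v (fst A x y) = fst B (lin u v x) (lin u v y)"
      "\<And>x y. lin u v (snd A x y) = snd B (lin u v x) (lin u v y)"
    using assms unfolding isomorphic_lin by blast
  have "bij (linv u v)"
    using d by (intro bij_betw_byWitness[where f' = "lin u v"]) auto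
  moreover have "linv u v (fst B x y) = fst A (linv u v x) (linv u v y)"
      "linv u v (snd B x y) = snd A (linv u v x) (linv u v y)" for x y
    using h[of "linv u v x" "linv u v y"] d by (metis lin_linv linv_lin)+
  ultimately show ?thesis unfolding isomorphic_def by (intro exI[of _ "linv u v"]) auto
qed

lemma orbit_cong: "isomorphic T T' \<Longrightarrow> orbit T = orbit T'"
  unfolding set_eq_iff orbit_iff_isomorphic using isomorphic_trans isomorphic_sym by blast

lemma str_Bil2 [simp]: "str T \<in> Bil2"
  using comm_pre_lie_str[of T] by (auto simp: Bil2_def comm_pre_lie_def split: prod.splits)

lemma bil_Bil2 [simp]: "(bil a b c d, bil a' b' c' d') \<in> Bil2"
  by (simp add: Bil2_def cbilinear_bil)

lemma cbilinear_alt: "cbilinear m \<longleftrightarrow>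
   (\<forall>x y z. m x (y + z) = m x y + m x z) \<and> (\<forall>x c y. m x (c *s y) = c *s m x y) \<and>
   (\<forall>x y z. m (x + y) z = m x z + m y z) \<and> (\<forall>c x y. m (c *s x) y = c *s m x y)"
  by (auto simp: cbilinear_def clinear_alt)

lemma cbilinear_eq_bil:
  assumes "cbilinear m" shows "m = bil (m e1 e1) (m e1 e2) (m e2 e1) (m e2 e2)"
proof (intro ext)
  fix x y
  have "m (x $ 1 *s e1 + x $ 2 *s e2) (y $ 1 *s e1 + y $ 2 *s e2) =
        bil (m e1 e1) (m e1 e2) (m e2 e1) (m e2 e2) x y"
    using assms by (simp add: cbilinear_alt bil_def vec_eq_iff algebra_simps)
  then show "m x y = bil (m e1 e1) (m e1 e2) (m e2 e1) (m e2 e2) x y" by (simp flip: V_expand)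
qed

lemma act_Bil2: "T \<in> Bil2 \<Longrightarrow> det2 u v \<noteq> 0 \<Longrightarrow> act (lin u v) T \<in> Bil2"
proof -
  assume T: "T \<in> Bil2" and d: "det2 u v \<noteq> 0"
  have "lin u v (x + y) = lin u v x + lin u v y" "linv u v (x + y) = linv u v x + linv u v y"
     "lin u v (c *s x) = c *s lin u v x" "linv u v (c *s x) = c *s linv u v x" for x y c
    using clinear_lin[of u v] clinear_linv[of u v] unfolding clinear_alt by blast+
  with T show ?thesis by (simp add: Bil2_def act_lin[OF d] cbilinear_alt)
qed

lemma orbit_Bil2: "T \<in> Bil2 \<Longrightarrow> orbit T \<subseteq> Bil2"
  using act_Bil2 unfolding orbit_iff_lin subset_iff by metis

section \<open>Regular functions\<close>

text \<open>A \<open>polyfun\<close> only sees products of basis vectors. Products of other vectors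
  are polynomial in these only for bilinear structures, hence the agreement on \<open>Bil2\<close>
  alone.\<close>

definition regular :: "(bilpair \<Rightarrow> complex) \<Rightarrow> bool" where
  "regular f \<longleftrightarrow> (\<exists>h. polyfun h \<and> (\<forall>S\<in>Bil2. f S = h S))"

definition vregular :: "(bilpair \<Rightarrow> V) \<Rightarrow> bool" where
  "vregular F \<longleftrightarrow> (\<forall>k. regular (\<lambda>S. F S $ k))"

lemma regular_polyfun: "polyfun f \<Longrightarrow> regular f"
  by (auto simp: regular_def)

named_theorems regular_intros

lemma regular_const [regular_intros]: "regular (\<lambda>_. c)"
  by (rule regular_polyfun, rule polyfun.const)

lemma regular_add [regular_intros]: "regular f \<Longrightarrow> regular g \<Longrightarrow> regular (\<lambda>S. f S + g S)"
  unfolding regular_def by (metis (no_types, lifting) polyfun.add)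

lemma regular_mult [regular_intros]: "regular f \<Longrightarrow> regular g \<Longrightarrow> regular (\<lambda>S. f S * g S)"
  unfolding regular_def by (metis (no_types, lifting) polyfun.mult)

lemma regular_minus [regular_intros]: "regular f \<Longrightarrow> regular (\<lambda>S. - f S)"
  using regular_mult[OF regular_const[of "-1"]] by simp

lemma regular_diff [regular_intros]: "regular f \<Longrightarrow> regular g \<Longrightarrow> regular (\<lambda>S. f S - g S)"
  using regular_add[OF _ regular_minus[of g]] by simp

lemma regular_nth [regular_intros]: "vregular F \<Longrightarrow> regular (\<lambda>S. F S $ k)"
  by (simp add: vregular_def)

lemma vregular_const [regular_intros]: "vregular (\<lambda>_. x)"
  by (simp add: vregular_def regular_intros)

lemma vregular_scale [regular_intros]: "regular f \<Longrightarrow> vregular F \<Longrightarrow> vregular (\<lambda>S. f S *s F S)"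
  by (simp add: vregular_def regular_intros)

lemma vregular_add [regular_intros]: "vregular F \<Longrightarrow> vregular G \<Longrightarrow> vregular (\<lambda>S. F S + G S)"
  by (simp add: vregular_def regular_intros)

lemma vregular_lin: "vregular F \<Longrightarrow> vregular (\<lambda>S. lin u v (F S))"
  by (simp add: lin_def regular_intros)

lemma regular_coord: "regular (\<lambda>S. fst S (axis i 1) (axis j 1) $ k)"
    "regular (\<lambda>S. snd S (axis i 1) (axis j 1) $ k)"
  using polyfun.coord1 polyfun.coord2 by (auto intro: regular_polyfun)

lemma regular_cong: "(\<And>S. S \<in> Bil2 \<Longrightarrow> f S = g S) \<Longrightarrow> regular f \<Longrightarrow> regular g"
  unfolding regular_def by metis

lemma vregular_prod [regular_intros]:
  assumes X: "vregular X" and Y: "vregular Y"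
  shows "vregular (\<lambda>S. fst S (X S) (Y S))" "vregular (\<lambda>S. snd S (X S) (Y S))"
proof -
  have eq: "fst S (X S) (Y S) $ k =
       bil (fst S e1 e1) (fst S e1 e2) (fst S e2 e1) (fst S e2 e2) (X S) (Y S) $ k"
     "snd S (X S) (Y S) $ k =
       bil (snd S e1 e1) (snd S e1 e2) (snd S e2 e1) (snd S e2 e2) (X S) (Y S) $ k"
    if "S \<in> Bil2" for S k
    using that cbilinear_eq_bil[of "fst S"] cbilinear_eq_bil[of "snd S"] by (auto simp: Bil2_def)
  show "vregular (\<lambda>S. fst S (X S) (Y S))" unfolding vregular_def
    by (intro allI, rule regular_cong[OF eq(1)[symmetric]], assumption)
       (unfold bil_nth, intro regular_add regular_mult regular_nth regular_coord X Y)
  show "vregular (\<lambda>S. snd S (X S) (Y S))" unfolding vregular_def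
    by (intro allI, rule regular_cong[OF eq(2)[symmetric]], assumption)
       (unfold bil_nth, intro regular_add regular_mult regular_nth regular_coord X Y)
qed

lemma regular_act:
  assumes f: "polyfun f" and d: "det2 u v \<noteq> 0"
  shows "regular (\<lambda>S. f (act (lin u v) S))"
  using f
proof induction
  case (coord1 i j k)
  show ?case by (simp add: act_lin[OF d]) (intro regular_intros vregular_lin)
next
  case (coord2 i j k)
  show ?case by (simp add: act_lin[OF d]) (intro regular_intros vregular_lin)
qed (auto intro: regular_intros)

section \<open>Zariski closures of orbits\<close>

lemma closure_zariski:
  assumes "X \<subseteq> Bil2"
  shows "zariski closure_of X = {S \<in> Bil2. \<forall>f. polyfun f \<longrightarrow> (\<forall>x\<in>X. f x = 0) \<longrightarrow> f S = 0}"
proof (rule closure_of_unique)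
  let ?F = "{f. polyfun f \<and> (\<forall>x\<in>X. f x = 0)}"
  have "{S \<in> Bil2. \<forall>f. polyfun f \<longrightarrow> (\<forall>x\<in>X. f x = 0) \<longrightarrow> f S = 0} = zero_locus ?F"
    by (auto simp: zero_locus_def)
  then show "closedin zariski {S \<in> Bil2. \<forall>f. polyfun f \<longrightarrow> (\<forall>x\<in>X. f x = 0) \<longrightarrow> f S = 0}"
    unfolding closedin_zariski by (intro exI[of _ ?F]) simp
next
  fix T assume "X \<subseteq> T" "closedin zariski T"
  then show "{S \<in> Bil2. \<forall>f. polyfun f \<longrightarrow> (\<forall>x\<in>X. f x = 0) \<longrightarrow> f S = 0} \<subseteq> T"
    by (force simp: closedin_zariski zero_locus_def)
qed (use assms in auto)

lemma closure_regular:
  assumes "S \<in> zariski closure_of X" "X \<subseteq> Bil2" "regular f" "\<And>x. x \<in> X \<Longrightarrow> f x = 0"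
  shows "f S = 0"
proof -
  obtain h where "polyfun h" "\<And>S. S \<in> Bil2 \<Longrightarrow> f S = h S"
    using assms(3) by (auto simp: regular_def)
  with assms show ?thesis by (auto simp: closure_zariski subset_iff)
qed

text \<open>Translation by a fixed group element is regular and maps the orbit to itself, so it
  preserves the polynomial equations that hold on the orbit.\<close>

lemma closure_orbit_invariant:
  assumes S: "S \<in> zariski closure_of orbit T" and T: "T \<in> Bil2" and iso: "isomorphic S S'"
  shows "S' \<in> zariski closure_of orbit T"
proof -
  obtain u v where d: "det2 u v \<noteq> 0" and S': "S' = act (lin u v) S"
    using iso orbit_iff_isomorphic orbit_iff_lin by metis
  have SB: "S \<in> Bil2" using S orbit_Bil2[OF T] by (simp add: closure_zariski)
  show ?thesis unfolding closure_zariski[OF orbit_Bil2[OF T]]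
  proof (safe)
    show "S' \<in> Bil2" unfolding S' by (rule act_Bil2[OF SB d])
  next
    fix f assume f: "polyfun f" "\<forall>x\<in>orbit T. f x = 0"
    have "f (act (lin u v) S) = 0"
    proof (rule closure_regular[OF S orbit_Bil2[OF T] regular_act[OF f(1) d]])
      fix x assume "x \<in> orbit T"
      then have "act (lin u v) x \<in> orbit T"
        unfolding orbit_iff_isomorphic
        using d isomorphic_trans orbit_iff_isomorphic orbit_iff_lin by metis
      with f show "f (act (lin u v) x) = 0" by blast
    qed
    then show "f S' = 0" by (simp add: S')
  qed
qed

text \<open>The closure is a union of orbits, so it contains one representative of \<open>T'\<close>
  exactly when it contains all of them.\<close>

lemma degenerates_iff:
  assumes "T \<in> Bil2"
  shows "degenerates T T' \<longleftrightarrow> T' \<in> zariski closure_of orbit T"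
  unfolding degenerates_def
  using closure_orbit_invariant[OF _ assms] isomorphic_sym isomorphic_refl
  by (metis orbit_iff_isomorphic)

lemma degenerates_isomorphic:
  assumes "T \<in> Bil2" "isomorphic T T'" shows "degenerates T T'"
proof -
  have "T' \<in> orbit T" using assms by (simp add: orbit_iff_isomorphic)
  then show ?thesis
    using assms(1) closure_of_subset[of "orbit T" zariski] orbit_Bil2[OF assms(1)]
    by (auto simp: degenerates_iff topspace_zariski)
qed

lemma degenerates_trans:
  assumes "degenerates A B" "degenerates B C" "A \<in> Bil2" "B \<in> Bil2"
  shows "degenerates A C"
proof -
  have B: "B \<in> zariski closure_of orbit A" and C: "C \<in> zariski closure_of orbit B"
    using assms by (simp_all add: degenerates_iff)
  have "orbit B \<subseteq> zariski closure_of orbit A"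
    using closure_orbit_invariant[OF B assms(3)] by (auto simp: orbit_iff_isomorphic)
  then have "zariski closure_of orbit B \<subseteq> zariski closure_of orbit A"
    by (simp add: closure_of_minimal)
  with C assms show ?thesis by (auto simp: degenerates_iff)
qed

section \<open>Degenerations along curves\<close>

text \<open>A polynomial that vanishes on the orbit vanishes along the curve near 0, hence at 0 by
  continuity. The exceptional parameter \<open>c\<close> leaves room for families of bases that
  become dependent at one further point.\<close>

lemma degenerates_curve:
  assumes T: "T \<in> Bil2" and p: "\<And>t. p t \<in> Bil2"
    and iso: "\<And>t. t \<noteq> 0 \<Longrightarrow> t \<noteq> c \<Longrightarrow> isomorphic T (p t)"
    and cont: "\<And>i j k. isCont (\<lambda>t. fst (p t) (axis i 1) (axis j 1) $ k) 0"
       "\<And>i j k. isCont (\<lambda>t. snd (p t) (axis i 1) (axis j 1) $ k) 0"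
  shows "degenerates T (p (0::complex))"
  unfolding degenerates_iff[OF T] closure_zariski[OF orbit_Bil2[OF T]]
proof (safe)
  fix f assume f: "polyfun f" and z: "\<forall>S\<in>orbit T. f S = 0"
  from f have "isCont (\<lambda>t. f (p t)) 0"
    by induction (auto intro: cont)
  then have lim: "((\<lambda>t. f (p t)) \<longlongrightarrow> f (p 0)) (at 0)" by (simp add: isCont_def)
  have "eventually (\<lambda>t. t \<noteq> c) (at (0::complex))" by (rule eventually_neq_at_within)
  moreover have "eventually (\<lambda>t. t \<noteq> 0) (at (0::complex))" by (rule eventually_neq_at_within)
  ultimately have "eventually (\<lambda>t. f (p t) = 0) (at 0)"
    by eventually_elim (use z iso in \<open>auto simp: orbit_iff_isomorphic\<close>)
  then have "((\<lambda>t. f (p t)) \<longlongrightarrow> 0) (at 0)" by (rule tendsto_eventually)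
  with lim show "f (p 0) = 0" by (rule tendsto_unique[rotated]) simp
qed (rule p)

lemma hom_bil:
  assumes "lin u v a = M u u" "lin u v b = M u v" "lin u v c = M v u" "lin u v d = M v v"
     and M: "cbilinear M"
  shows "lin u v (bil a b c d x y) = M (lin u v x) (lin u v y)"
proof -
  have "lin u v (bil a b c d x y) = bil (M u u) (M u v) (M v u) (M v v) x y"
    by (simp flip: assms(1-4)) (simp add: V_eq_iff lin_nth bil_nth algebra_simps)
  also have "\<dots> = M (lin u v x) (lin u v y)"
    using M by (simp add: lin_def cbilinear_alt bil_def vec_eq_iff algebra_simps)
  finally show ?thesis .
qed

text \<open>\<open>u\<close> and \<open>v\<close> are a basis in which \<open>T\<close> has the structure constants \<open>a, b, \<dots>\<close>.\<close>
lemma isomorphic_bil: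
  assumes "T \<in> Bil2" "det2 u v \<noteq> 0"
    "lin u v a = fst T u u" "lin u v b = fst T u v" "lin u v c = fst T v u" "lin u v d = fst T v v"
    "lin u v a' = snd T u u" "lin u v b' = snd T u v" "lin u v c' = snd T v u" "lin u v d' = snd T v v"
  shows "isomorphic T (bil a b c d, bil a' b' c' d')"
proof (rule isomorphic_sym)
  show "isomorphic (bil a b c d, bil a' b' c' d') T"
    unfolding isomorphic_lin using assms
    by (intro exI[of _ u] exI[of _ v]) (auto intro!: hom_bil simp: Bil2_def)
qed

lemma degenerates_bil:
  fixes u v :: "complex \<Rightarrow> V"
  assumes T: "T \<in> Bil2"
    and iso: "\<And>t. t \<noteq> 0 \<Longrightarrow> t \<noteq> r \<Longrightarrow> det2 (u t) (v t) \<noteq> 0 \<and>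
      lin (u t) (v t) (a t) = fst T (u t) (u t) \<and> lin (u t) (v t) (b t) = fst T (u t) (v t) \<and>
      lin (u t) (v t) (c t) = fst T (v t) (u t) \<and> lin (u t) (v t) (d t) = fst T (v t) (v t) \<and>
      lin (u t) (v t) (a' t) = snd T (u t) (u t) \<and> lin (u t) (v t) (b' t) = snd T (u t) (v t) \<and>
      lin (u t) (v t) (c' t) = snd T (v t) (u t) \<and> lin (u t) (v t) (d' t) = snd T (v t) (v t)"
    and cont: "\<And>k. isCont (\<lambda>t. a t $ k) 0" "\<And>k. isCont (\<lambda>t. b t $ k) 0"
      "\<And>k. isCont (\<lambda>t. c t $ k) 0" "\<And>k. isCont (\<lambda>t. d t $ k) 0"
      "\<And>k. isCont (\<lambda>t. a' t $ k) 0" "\<And>k. isCont (\<lambda>t. b' t $ k) 0"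
      "\<And>k. isCont (\<lambda>t. c' t $ k) 0" "\<And>k. isCont (\<lambda>t. d' t $ k) 0"
    and lim: "T' = (bil (a 0) (b 0) (c 0) (d 0), bil (a' 0) (b' 0) (c' 0) (d' 0))"
  shows "degenerates T T'"
  unfolding lim
proof (rule degenerates_curve[where c = r, OF T])
  fix t assume "t \<noteq> 0" "t \<noteq> r"
  from iso[OF this] show "isomorphic T (bil (a t) (b t) (c t) (d t), bil (a' t) (b' t) (c' t) (d' t))"
    by (intro isomorphic_bil[OF T, where u = "u t" and v = "v t"]) auto
qed (auto simp: bil_nth intro!: continuous_intros cont)

text \<open>In the degenerations to \<open>C17 \<beta>\<close> the basis is \<open>u\<close> and \<open>v = u \<cdot> u\<close>, with \<open>u\<close> chosen such that the
  coordinates of \<open>u \<circ> u - \<beta> v\<close> in this basis tend to \<open>0\<close>.\<close>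
lemma primary_degenerates:
  assumes "primary T T'" shows "degenerates (str T) (str T')"
proof -
  note D = degenerates_bil[OF str_Bil2]
  note s = V_eq_iff lin_nth bil_nth e_nth det2_def algebra_simps power2_eq_square power3_eq_cube
  note c0 = D[where a = "\<lambda>_. 0" and b = "\<lambda>_. 0" and c = "\<lambda>_. 0" and d = "\<lambda>_. 0" and r = 0]
  note p0 = D[where a' = "\<lambda>_. 0" and b' = "\<lambda>_. 0" and c' = "\<lambda>_. 0" and d' = "\<lambda>_. 0" and r = 0]
  \<comment> \<open>Scaling the basis by t scales every structure constant by t.\<close>
  have zero: "degenerates (bil a b c d, bil a' b' c' d') (str Zero)" for a b c d a' b' c' d'
    by (rule degenerates_bil[where u = "\<lambda>t. t *s e1" and v = "\<lambda>t. t *s e2" and r = 0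
          and a = "\<lambda>t. t *s a" and b = "\<lambda>t. t *s b" and c = "\<lambda>t. t *s c" and d = "\<lambda>t. t *s d"
          and a' = "\<lambda>t. t *s a'" and b' = "\<lambda>t. t *s b'" and c' = "\<lambda>t. t *s c'" and d' = "\<lambda>t. t *s d'"])
       (auto simp: s intro!: continuous_intros)
  show ?thesis using assms
  proof cases
    case 1 show ?thesis unfolding 1
      by (rule c0[where u = "\<lambda>t. e1" and v = "\<lambda>t. t *s e2"
         and a' = "\<lambda>_. e1" and b' = "\<lambda>_. 0" and c' = "\<lambda>_. 0" and d' = "\<lambda>t. t *s e2"])
         (auto simp: s intro!: continuous_intros)
  next
    case 2 show ?thesis unfolding 2
      by (rule c0[where u = "\<lambda>t. e1 + e2" and v = "\<lambda>t. t *s e2"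
         and a' = "\<lambda>_. e1" and b' = "\<lambda>_. e2" and c' = "\<lambda>_. e2" and d' = "\<lambda>t. t *s e2"])
         (auto simp: s intro!: continuous_intros)
  next
    \<comment> \<open>Here \<open>e2\<close> is idempotent, and e1 - 2 e2 is an eigenvector of its
      left multiplication for 1/2 and is killed by its right multiplication. The factor t removes
      the square of that vector. For \<open>C15 \<gamma>\<close> below, e2/2 and e1 - \<gamma> e2
      play these parts.\<close>
    case 3 show ?thesis unfolding 3
      by (rule c0[where u = "\<lambda>t. e2" and v = "\<lambda>t. t *s (e1 - 2 *s e2)"
         and a' = "\<lambda>_. e1" and b' = "\<lambda>_. (1/2) *s e2" and c' = "\<lambda>_. 0" and d' = "\<lambda>t. (-2 * t\<^sup>2) *s e1"])
         (auto simp: s intro!: continuous_intros)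
  next
    case 4 show ?thesis unfolding 4
      by (rule c0[where u = "\<lambda>t. e1" and v = "\<lambda>t. t *s e2"
         and a' = "\<lambda>_. e1" and b' = "\<lambda>_. 2 *s e2" and c' = "\<lambda>t. (t/2) *s e1 + e2" and d' = "\<lambda>t. t *s e2"])
         (auto simp: s intro!: continuous_intros)
  next
    case 5 show ?thesis unfolding 5
      by (rule p0[where u = "\<lambda>t. e1 + e2" and v = "\<lambda>t. t *s e2"
         and a = "\<lambda>_. e1" and b = "\<lambda>_. e2" and c = "\<lambda>t. e2" and d = "\<lambda>t. t *s e2"])
         (auto simp: s intro!: continuous_intros)
  next
    case 6 show ?thesis unfolding 6
      by (rule p0[where u = "\<lambda>t. e1" and v = "\<lambda>t. t *s e2"
         and a = "\<lambda>_. e1" and b = "\<lambda>_. 0" and c = "\<lambda>t. 0" and d = "\<lambda>t. t *s e2"])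
         (auto simp: s intro!: continuous_intros)
  next
    case 7 show ?thesis unfolding 7
      by (rule D[where r = 0 and u = "\<lambda>t. e2" and v = "\<lambda>t. t *s e1"
         and a = "\<lambda>_. 0" and b = "\<lambda>t. t *s e1" and c = "\<lambda>t. t *s e1" and d = "\<lambda>t. t *s e2"
         and a' = "\<lambda>_. e1" and b' = "\<lambda>_. 0" and c' = "\<lambda>_. 0" and d' = "\<lambda>_. 0"])
         (auto simp: s intro!: continuous_intros)
  next
    case 8 show ?thesis unfolding 8
      by (rule D[where r = 0 and u = "\<lambda>t. e1" and v = "\<lambda>t. t *s e2"
         and a = "\<lambda>_. e1" and b = "\<lambda>t. e2" and c = "\<lambda>t. e2" and d = "\<lambda>t. 0"
         and a' = "\<lambda>_. 0" and b' = "\<lambda>_. 0" and c' = "\<lambda>_. 0" and d' = "\<lambda>t. t *s e2"])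
         (auto simp: s intro!: continuous_intros)
  next
    case (9 \<beta>)
    let ?p = "\<lambda>t. (- (t * (\<beta> + t))) *s e1 + (\<beta> + t) *s e2" and ?m = "\<lambda>t. (- t\<^sup>2) *s e1 + (2 * t) *s e2"
    \<comment> \<open>This is the determinant of the basis. Using \<beta> + t instead of \<beta>
      keeps it nonzero for small t \<noteq> 0 even when \<beta> = 0.\<close>
    have *: "t * (t * (t * t)) + t * (t * (t * \<beta>)) \<noteq> 0" if "t \<noteq> 0" "t \<noteq> - \<beta>" for t
    proof -
      have "t * (t * (t * t)) + t * (t * (t * \<beta>)) = t ^ 3 * (t + \<beta>)"
        by (simp add: algebra_simps power3_eq_cube)
      with that show ?thesis by (simp add: eq_neg_iff_add_eq_0)
    qed
    show ?thesis unfolding 9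
      by (rule D[where r = "- \<beta>" and u = "\<lambda>t. t *s e1 + (t * (\<beta> + t)) *s e2"
         and v = "\<lambda>t. t\<^sup>2 *s e1 + (2 * t\<^sup>2 * (\<beta> + t)) *s e2"
         and a = "\<lambda>_. e2" and b = ?m and c = ?m and d = "\<lambda>t. (-2 * t^3) *s e1 + (3 * t\<^sup>2) *s e2"
         and a' = ?p and b' = "\<lambda>t. (2 * t) *s ?p t" and c' = "\<lambda>t. (2 * t) *s ?p t" and d' = "\<lambda>t. (4 * t\<^sup>2) *s ?p t"])
         (auto simp: s intro!: continuous_intros simp: *)
  next
    case 10 show ?thesis unfolding 10
      by (rule D[where r = 0 and u = "\<lambda>t. e2" and v = "\<lambda>t. t *s e1"
         and a = "\<lambda>_. 0" and b = "\<lambda>t. 0" and c = "\<lambda>t. 0" and d = "\<lambda>t. t *s e2"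
         and a' = "\<lambda>_. e1" and b' = "\<lambda>_. 0" and c' = "\<lambda>_. 0" and d' = "\<lambda>_. 0"])
         (auto simp: s intro!: continuous_intros)
  next
    case 11 show ?thesis unfolding 11
      by (rule D[where r = 0 and u = "\<lambda>t. e1" and v = "\<lambda>t. t *s e2"
         and a = "\<lambda>_. e1" and b = "\<lambda>t. 0" and c = "\<lambda>t. 0" and d = "\<lambda>t. 0"
         and a' = "\<lambda>_. 0" and b' = "\<lambda>_. 0" and c' = "\<lambda>_. 0" and d' = "\<lambda>t. t *s e2"])
         (auto simp: s intro!: continuous_intros)
  next
    case (12 \<beta>)
    have *: "t * (t * (t * t)) + t * (t * (t * \<beta>)) \<noteq> 0" if "t \<noteq> 0" "t \<noteq> - \<beta>" for t
    proof -
      have "t * (t * (t * t)) + t * (t * (t * \<beta>)) = t ^ 3 * (t + \<beta>)"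
        by (simp add: algebra_simps power3_eq_cube)
      with that show ?thesis by (simp add: eq_neg_iff_add_eq_0)
    qed
    show ?thesis unfolding 12
      by (rule D[where r = "- \<beta>" and u = "\<lambda>t. t *s e1 - (t * (\<beta> + t)) *s e2"
         and v = "\<lambda>t. t\<^sup>2 *s e1"
         and a = "\<lambda>_. e2" and b = "\<lambda>t. t *s e2" and c = "\<lambda>t. t *s e2" and d = "\<lambda>t. t\<^sup>2 *s e2"
         and a' = "\<lambda>t. (- (t * (\<beta> + t))) *s e1 + (\<beta> + t) *s e2" and b' = "\<lambda>t. 0" and c' = "\<lambda>t. 0" and d' = "\<lambda>t. 0"])
         (auto simp: s intro!: continuous_intros simp: *)
  next
    \<comment> \<open>Enlarging \<open>e2\<close> makes the first product vanish in the limit: its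
      only value e1 \<cdot> e1 = e2 is t v.\<close>
    case 13 show ?thesis unfolding 13
      by (rule D[where r = 0 and u = "\<lambda>t. e1" and v = "\<lambda>t. (1/t) *s e2"
         and a = "\<lambda>t. t *s e2" and b = "\<lambda>t. 0" and c = "\<lambda>t. 0" and d = "\<lambda>t. 0"
         and a' = "\<lambda>_. e1" and b' = "\<lambda>_. 2 *s e2" and c' = "\<lambda>_. 0" and d' = "\<lambda>t. 0"])
         (auto simp: s intro!: continuous_intros)
  next
    case (14 \<beta>) show ?thesis unfolding 14
      by (rule D[where r = 0 and u = "\<lambda>t. t *s e1 + (\<beta> * t) *s e2" and v = "\<lambda>t. t\<^sup>2 *s e2"
         and a = "\<lambda>t. e2" and b = "\<lambda>t. 0" and c = "\<lambda>t. 0" and d = "\<lambda>t. 0"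
         and a' = "\<lambda>t. t *s e1 + \<beta> *s e2" and b' = "\<lambda>t. (2 * t) *s e2" and c' = "\<lambda>_. 0" and d' = "\<lambda>t. 0"])
         (auto simp: s intro!: continuous_intros)
  next
    case (15 \<gamma>) show ?thesis unfolding 15
      by (rule D[where r = 0 and u = "\<lambda>t. (1/2) *s e2" and v = "\<lambda>t. t *s (e1 - \<gamma> *s e2)"
         and a = "\<lambda>t. 0" and b = "\<lambda>t. 0" and c = "\<lambda>t. 0" and d = "\<lambda>t. (2 * t\<^sup>2) *s e1"
         and a' = "\<lambda>t. e1" and b' = "\<lambda>t. (1/2) *s e2" and c' = "\<lambda>_. 0" and d' = "\<lambda>t. (-2 * \<gamma>\<^sup>2 * t\<^sup>2) *s e1"])
         (auto simp: s intro!: continuous_intros)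
  next
    case (16 \<gamma> \<beta>)
    \<comment> \<open>With u = t (e1 + (q - \<gamma>) e2) and v = u \<cdot> u one gets u \<circ> u =
      t q u + (q^2 - \<gamma>^2) v, so q^2 - \<gamma>^2 has to be \<beta>.\<close>
    define q where "q = csqrt (\<gamma>\<^sup>2 + \<beta>)"
    have \<beta>: "\<beta> = q * q - \<gamma> * \<gamma>" using power2_csqrt[of "\<gamma>\<^sup>2 + \<beta>"]
      by (simp add: q_def power2_eq_square algebra_simps)
    show ?thesis unfolding 16 \<beta>
      by (rule D[where r = 0 and u = "\<lambda>t. t *s e1 + ((q - \<gamma>) * t) *s e2" and v = "\<lambda>t. t\<^sup>2 *s e2"
         and a = "\<lambda>t. e2" and b = "\<lambda>t. 0" and c = "\<lambda>t. 0" and d = "\<lambda>t. 0"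
         and a' = "\<lambda>t. (t * q) *s e1 + (q * q - \<gamma> * \<gamma>) *s e2" and b' = "\<lambda>t. (2 * t * q) *s e2"
         and c' = "\<lambda>t. t\<^sup>2 *s e1 + (t * q) *s e2" and d' = "\<lambda>t. (2 * t\<^sup>2) *s e2"])
         (auto simp: s intro!: continuous_intros)
  next
    case 17 show ?thesis unfolding 17
      by (rule D[where r = 0 and u = "\<lambda>t. e1" and v = "\<lambda>t. (1/t) *s e2"
         and a = "\<lambda>t. t *s e2" and b = "\<lambda>t. 0" and c = "\<lambda>t. 0" and d = "\<lambda>t. 0"
         and a' = "\<lambda>_. e1" and b' = "\<lambda>_. 2 *s e2" and c' = "\<lambda>_. e2" and d' = "\<lambda>t. 0"])
         (auto simp: s intro!: continuous_intros)
  next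
    case (18 \<beta>) show ?thesis unfolding 18
      by (rule D[where r = 0 and u = "\<lambda>t. t *s e1 + (\<beta> * t / 2) *s e2" and v = "\<lambda>t. t\<^sup>2 *s e2"
         and a = "\<lambda>t. e2" and b = "\<lambda>t. 0" and c = "\<lambda>t. 0" and d = "\<lambda>t. 0"
         and a' = "\<lambda>t. t *s e1 + \<beta> *s e2" and b' = "\<lambda>t. (2 * t) *s e2" and c' = "\<lambda>t. t *s e2" and d' = "\<lambda>t. 0"])
         (auto simp: s intro!: continuous_intros)
  next
    case (19 \<alpha>)
    let ?p = "\<lambda>t. (- (\<alpha> * t)) *s e1 + \<alpha> *s e2" and ?m = "\<lambda>t. (- t\<^sup>2) *s e1 + (2 * t) *s e2"
    show ?thesis unfolding 19
      by (rule D[where r = 0 and u = "\<lambda>t. t *s e1 + e2" and v = "\<lambda>t. t\<^sup>2 *s e1 + (2 * t) *s e2"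
         and a = "\<lambda>_. e2" and b = ?m and c = ?m and d = "\<lambda>t. (-2 * t^3) *s e1 + (3 * t\<^sup>2) *s e2"
         and a' = ?p and b' = "\<lambda>t. (2 * t) *s ?p t" and c' = "\<lambda>t. t *s ?p t" and d' = "\<lambda>t. (2 * t\<^sup>2) *s ?p t"])
         (auto simp: s intro!: continuous_intros)
  next
    case (20 \<alpha>)
    let ?p = "\<lambda>t. (\<alpha> * t) *s e1 - \<alpha> *s e2"
    show ?thesis unfolding 20
      by (rule D[where r = 0 and u = "\<lambda>t. t *s e1 + e2" and v = "\<lambda>t. t\<^sup>2 *s e1"
         and a = "\<lambda>_. e2" and b = "\<lambda>t. t *s e2" and c = "\<lambda>t. t *s e2" and d = "\<lambda>t. t\<^sup>2 *s e2"
         and a' = ?p and b' = "\<lambda>t. 0" and c' = "\<lambda>t. t *s ?p t" and d' = "\<lambda>t. 0"])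
         (auto simp: s intro!: continuous_intros)
  next
    case 21 show ?thesis unfolding 21
      by (rule c0[where u = "\<lambda>t. e1" and v = "\<lambda>t. (1/t) *s e2"
         and a' = "\<lambda>t. e1 + t *s e2" and b' = "\<lambda>_. 0" and c' = "\<lambda>_. e2" and d' = "\<lambda>t. 0"])
         (auto simp: s intro!: continuous_intros)
  next
    case 22 show ?thesis unfolding 22
      by (rule c0[where u = "\<lambda>t. t *s e1" and v = "\<lambda>t. t\<^sup>2 *s e2"
         and a' = "\<lambda>t. t *s e1 + e2" and b' = "\<lambda>_. 0" and c' = "\<lambda>t. t *s e2" and d' = "\<lambda>t. 0"])
         (auto simp: s intro!: continuous_intros)
  next
    case 23 show ?thesis unfolding 23
      by (rule c0[where u = "\<lambda>t. e1" and v = "\<lambda>t. (1/t) *s e2"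
         and a' = "\<lambda>t. e1 + t *s e2" and b' = "\<lambda>_. e2" and c' = "\<lambda>_. 0" and d' = "\<lambda>t. 0"])
         (auto simp: s intro!: continuous_intros)
  next
    case 24 show ?thesis unfolding 24
      by (rule c0[where u = "\<lambda>t. t *s e1" and v = "\<lambda>t. t\<^sup>2 *s e2"
         and a' = "\<lambda>t. t *s e1 + e2" and b' = "\<lambda>t. t *s e2" and c' = "\<lambda>t. 0" and d' = "\<lambda>t. 0"])
         (auto simp: s intro!: continuous_intros)
  next
    case 25 show ?thesis unfolding 25
      by (rule c0[where u = "\<lambda>t. e1 + t *s e2" and v = "\<lambda>t. t *s e1"
         and a' = "\<lambda>t. e2" and b' = "\<lambda>t. t *s e2" and c' = "\<lambda>t. 0" and d' = "\<lambda>t. 0"])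
         (auto simp: s intro!: continuous_intros)
  next
    \<comment> \<open>The vector v is u \<circ> u - t u. It is 0 when \<alpha> = 1, where u \<circ>
      u is always a multiple of u.\<close>
    case (26 \<alpha>) then show ?thesis unfolding 26
      by (intro c0[where u = "\<lambda>t. t *s e1 + e2" and v = "\<lambda>t. (t * (\<alpha> - 1)) *s e2"
         and a' = "\<lambda>t. t *s e1 + e2" and b' = "\<lambda>t. (t * \<alpha>) *s e2" and c' = "\<lambda>t. 0" and d' = "\<lambda>t. 0"])
         (auto simp: s intro!: continuous_intros)
  next
    case (27 \<alpha>) then show ?thesis unfolding 27
      by (intro c0[where u = "\<lambda>t. t *s e1 + e2" and v = "\<lambda>t. (t * \<alpha>) *s e2"
         and a' = "\<lambda>t. t *s e1 + e2" and b' = "\<lambda>t. (t * \<alpha>) *s e2" and c' = "\<lambda>t. t *s e2" and d' = "\<lambda>t. 0"])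
         (auto simp: s intro!: continuous_intros)
  \<comment> \<open>\<open>str Zero\<close> has to stay folded to match \<open>zero\<close>.\<close>
  qed (simp_all del: str.simps(18) add: zero)
qed

section \<open>Covariant identities\<close>

definition trace2 :: "(V \<Rightarrow> V) \<Rightarrow> complex" where
  "trace2 F = F e1 $ 1 + F e2 $ 2"

abbreviation trL :: "product \<Rightarrow> V \<Rightarrow> complex" where "trL m x \<equiv> trace2 (\<lambda>y. m x y)"
abbreviation trR :: "product \<Rightarrow> V \<Rightarrow> complex" where "trR m x \<equiv> trace2 (\<lambda>y. m y x)"

lemma trace2_conjugate:
  assumes F: "clinear F" and G: "clinear G" and d: "det2 u v \<noteq> 0"
    and eq: "\<And>y. lin u v (F y) = G (lin u v y)"
  shows "trace2 F = trace2 G"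
proof -
  have 1: "F e1 $ 1 * u $ i + F e1 $ 2 * v $ i = u $ 1 * G e1 $ i + u $ 2 * G e2 $ i" for i
    using arg_cong[OF eq[of e1], of "\<lambda>z. z $ i"] by (simp add: lin_nth clinear_eq_lin[OF G, THEN fun_cong, of u])
  have 2: "F e2 $ 1 * u $ i + F e2 $ 2 * v $ i = v $ 1 * G e1 $ i + v $ 2 * G e2 $ i" for i
    using arg_cong[OF eq[of e2], of "\<lambda>z. z $ i"] by (simp add: lin_nth clinear_eq_lin[OF G, THEN fun_cong, of v])
  \<comment> \<open>With P the matrix of columns u, v, this follows from the entries of P F = G P
    alone, without inverting P.\<close>
  have "det2 u v * trace2 F = det2 u v * trace2 G"
    using 1[of 1] 1[of 2] 2[of 1] 2[of 2] unfolding det2_def trace2_def by algebra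
  with d show ?thesis by simp
qed

lemma Bil2_clinear:
  "S \<in> Bil2 \<Longrightarrow> clinear (fst S x)" "S \<in> Bil2 \<Longrightarrow> clinear (snd S x)"
  "S \<in> Bil2 \<Longrightarrow> clinear (\<lambda>y. snd S y x)"
  by (simp_all add: Bil2_def cbilinear_def)

lemma trace_act:
  assumes "T \<in> Bil2" "det2 u v \<noteq> 0"
  shows "trL (fst (act (lin u v) T)) (lin u v x) = trL (fst T) x"
    "trL (snd (act (lin u v) T)) (lin u v x) = trL (snd T) x"
    "trR (snd (act (lin u v) T)) (lin u v x) = trR (snd T) x"
proof -
  note c = trace2_conjugate[OF _ _ assms(2), symmetric] and i = Bil2_clinear assms(1) act_Bil2[OF assms]
  show "trL (fst (act (lin u v) T)) (lin u v x) = trL (fst T) x"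
    by (rule c) (simp_all add: i, simp add: act_lin assms)
  show "trL (snd (act (lin u v) T)) (lin u v x) = trL (snd T) x"
    by (rule c) (simp_all add: i, simp add: act_lin assms)
  show "trR (snd (act (lin u v) T)) (lin u v x) = trR (snd T) x"
    by (rule c) (simp_all add: i, simp add: act_lin assms)
qed

lemma regular_trace2 [regular_intros]: "(\<And>x. vregular (\<lambda>S. F S x)) \<Longrightarrow> regular (\<lambda>S. trace2 (F S))"
  by (simp add: trace2_def regular_intros)

text \<open>Each of the following identities between covariants is invariant under the group and closed,
  hence passes from an algebra to its degenerations.\<close>
definition vector_identity :: "complex \<Rightarrow> complex \<Rightarrow> complex \<Rightarrow> complex \<Rightarrow> complex \<Rightarrow> complex \<Rightarrow> complex \<Rightarrow> bilpair \<Rightarrow> bool"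
  where "vector_identity a b c d e f h S \<longleftrightarrow> (\<forall>x y. a *s snd S x y + b *s snd S y x + c *s fst S x y
    + (d * trL (fst S) x) *s y + (e * trL (fst S) y) *s x
    + (f * trR (snd S) x) *s y + (h * trR (snd S) y) *s x = 0)"

definition linear_identity :: "complex \<Rightarrow> complex \<Rightarrow> complex \<Rightarrow> bilpair \<Rightarrow> bool"
  where "linear_identity a b c S \<longleftrightarrow> (\<forall>x. a * trL (snd S) x + b * trR (snd S) x + c * trL (fst S) x = 0)"

definition bilinear_identity :: "complex \<Rightarrow> complex \<Rightarrow> complex \<Rightarrow> complex \<Rightarrow> complex \<Rightarrow> bilpair \<Rightarrow> bool"
  where "bilinear_identity a b c d e S \<longleftrightarrow> (\<forall>x y. a * trR (snd S) (snd S x y) + b * trR (snd S) (fst S x y)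
    + c * (trR (snd S) x * trR (snd S) y)
    + d * trL (fst S) (fst S x y) + e * (trL (fst S) x * trL (fst S) y) = 0)"

lemma closed_orbit_condition:
  assumes deg: "degenerates T T'" and T: "T \<in> Bil2" and f: "regular f"
    and "\<And>u v. det2 u v \<noteq> 0 \<Longrightarrow> f (act (lin u v) T) = 0"
  shows "f T' = 0"
  using deg unfolding degenerates_iff[OF T]
  by (rule closure_regular[OF _ orbit_Bil2[OF T] f]) (use assms(4) in \<open>metis orbit_iff_lin\<close>)

text \<open>Every vector is an image g x', and products and traces are transported by g. So the
  identity at images is g applied to the identity for \<open>T\<close>, and each coordinate of it is
  a regular equation.\<close>

lemma vector_identity_degenerates:
  assumes deg: "degenerates T T'" and T: "T \<in> Bil2" and i: "vector_identity a b c d e f h T"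
  shows "vector_identity a b c d e f h T'"
  unfolding vector_identity_def
proof (intro allI, rule vec_eq_iff[THEN iffD2, rule_format], unfold zero_index,
    rule closed_orbit_condition[OF deg T, where f = "\<lambda>S. (a *s snd S x y + b *s snd S y x + c *s fst S x y
    + (d * trL (fst S) x) *s y + (e * trL (fst S) y) *s x
    + (f * trR (snd S) x) *s y + (h * trR (snd S) y) *s x) $ k" for x y k])
  fix x y k u v assume D: "det2 u v \<noteq> 0"
  let ?S = "act (lin u v) T" and ?g = "lin u v"
  obtain x' y' where xy: "x = ?g x'" "y = ?g y'" using lin_linv[OF D] by metis
  have "?g (a *s snd T x' y' + b *s snd T y' x' + c *s fst T x' y'
    + (d * trL (fst T) x') *s y' + (e * trL (fst T) y') *s x'
    + (f * trR (snd T) x') *s y' + (h * trR (snd T) y') *s x') = ?g 0"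
    using i by (auto simp: vector_identity_def)
  then have "a *s ?g (snd T x' y') + b *s ?g (snd T y' x') + c *s ?g (fst T x' y')
    + (d * trL (fst T) x') *s ?g y' + (e * trL (fst T) y') *s ?g x'
    + (f * trR (snd T) x') *s ?g y' + (h * trR (snd T) y') *s ?g x' = 0"
    using clinear_lin[of u v] by (simp add: clinear_alt) (simp add: lin_def)
  moreover have "snd ?S (?g x) (?g y) = ?g (snd T x y)" "fst ?S (?g x) (?g y) = ?g (fst T x y)" for x y
    using D by (simp_all add: act_lin)
  ultimately show "(a *s snd ?S x y + b *s snd ?S y x + c *s fst ?S x y
    + (d * trL (fst ?S) x) *s y + (e * trL (fst ?S) y) *s x
    + (f * trR (snd ?S) x) *s y + (h * trR (snd ?S) y) *s x) $ k = 0"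
    unfolding xy trace_act[OF T D] by simp
qed (intro regular_intros)

lemma linear_identity_degenerates:
  assumes deg: "degenerates T T'" and T: "T \<in> Bil2" and i: "linear_identity a b c T"
  shows "linear_identity a b c T'"
  unfolding linear_identity_def
proof (intro allI, rule closed_orbit_condition[OF deg T,
    where f = "\<lambda>S. a * trL (snd S) x + b * trR (snd S) x + c * trL (fst S) x" for x])
  fix x u v assume D: "det2 u v \<noteq> 0"
  obtain x' where x: "x = lin u v x'" using lin_linv[OF D] by metis
  show "a * trL (snd (act (lin u v) T)) x + b * trR (snd (act (lin u v) T)) x
      + c * trL (fst (act (lin u v) T)) x = 0"
    unfolding x trace_act[OF T D] using i by (simp add: linear_identity_def)
qed (intro regular_intros)

lemma bilinear_identity_degenerates:
  assumes deg: "degenerates T T'" and T: "T \<in> Bil2" and i: "bilinear_identity a b c d e T"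
  shows "bilinear_identity a b c d e T'"
  unfolding bilinear_identity_def
proof (intro allI, rule closed_orbit_condition[OF deg T,
    where f = "\<lambda>S. a * trR (snd S) (snd S x y) + b * trR (snd S) (fst S x y)
    + c * (trR (snd S) x * trR (snd S) y)
    + d * trL (fst S) (fst S x y) + e * (trL (fst S) x * trL (fst S) y)" for x y])
  fix x y u v assume D: "det2 u v \<noteq> 0"
  let ?S = "act (lin u v) T" and ?g = "lin u v"
  obtain x' y' where xy: "x = ?g x'" "y = ?g y'" using lin_linv[OF D] by metis
  have "snd ?S (?g x) (?g y) = ?g (snd T x y)" "fst ?S (?g x) (?g y) = ?g (fst T x y)" for x y
    using D by (simp_all add: act_lin)
  then show "a * trR (snd ?S) (snd ?S x y) + b * trR (snd ?S) (fst ?S x y)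
    + c * (trR (snd ?S) x * trR (snd ?S) y)
    + d * trL (fst ?S) (fst ?S x y) + e * (trL (fst ?S) x * trL (fst ?S) y) = 0"
    unfolding xy trace_act[OF T D] using i by (simp add: bilinear_identity_def trace_act[OF T D])
qed (intro regular_intros)

text \<open>Instances at basis vectors, quantified over indices so that \<open>forall_2\<close>
  turns them into finitely many equations between numbers.\<close>

lemma linear_identity_str:
  "linear_identity a b c S \<Longrightarrow> (\<forall>i. a * trL (snd S) (axis i 1) + b * trR (snd S) (axis i 1) + c * trL (fst S) (axis i 1) = 0)"
  by (simp add: linear_identity_def)

lemma vector_identity_str: "vector_identity a b c d e f h S \<Longrightarrow> (\<forall>i j.
   a *s snd S (axis i 1) (axis j 1) + b *s snd S (axis j 1) (axis i 1) + c *s fst S (axis i 1) (axis j 1)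
    + (d * trL (fst S) (axis i 1)) *s axis j 1 + (e * trL (fst S) (axis j 1)) *s axis i 1
    + (f * trR (snd S) (axis i 1)) *s axis j 1 + (h * trR (snd S) (axis j 1)) *s axis i 1 = 0)"
  by (simp add: vector_identity_def)

lemma bilinear_identity_str: "bilinear_identity a b c d e S \<Longrightarrow> (\<forall>i j.
   a * trR (snd S) (snd S (axis i 1) (axis j 1)) + b * trR (snd S) (fst S (axis i 1) (axis j 1))
    + c * (trR (snd S) (axis i 1) * trR (snd S) (axis j 1))
    + d * trL (fst S) (fst S (axis i 1) (axis j 1)) + e * (trL (fst S) (axis i 1) * trL (fst S) (axis j 1)) = 0)"
  by (simp add: bilinear_identity_def)

lemmas identities_def = vector_identity_def linear_identity_def bilinear_identity_def

lemma identities_degenerate: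
  assumes "degenerates (str T) (str T')"
  shows "vector_identity a b c d e f h (str T) \<Longrightarrow> vector_identity a b c d e f h (str T')"
    "linear_identity a b c (str T) \<Longrightarrow> linear_identity a b c (str T')"
    "bilinear_identity a b c d e (str T) \<Longrightarrow> bilinear_identity a b c d e (str T')"
  using vector_identity_degenerates linear_identity_degenerates bilinear_identity_degenerates assms by auto

lemmas eval = identities_def trace2_def bil_nth e_nth V_eq_iff
lemmas eval_str = trace2_def bil_nth e_nth V_eq_iff forall_2

section \<open>Members of the list that satisfy the identities of a given algebra\<close>

text \<open>The ratio of \<open>trL\<close> to \<open>trR\<close> is 1/2 here, 1 + \<alpha> on
  \<open>C05 \<alpha>\<close> and (1 + \<alpha>)/2 on \<open>C06 \<alpha>\<close>, which leaves
  \<open>C05 (- 1/2)\<close> and \<open>C06 0\<close>. The relation 2 trR(x \<circ> y) = trR x trR y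
  holds on \<open>C06 \<alpha>\<close>; on \<open>C05 \<alpha>\<close> the factor is 1 instead of
  2.\<close>

lemma degenerates_C01:
  assumes "degenerates (str C01) (str T)" shows "T \<in> {C01, C06 0, C03, Zero}"
proof -
  note D = identities_degenerate[OF assms]
  have h1: "vector_identity 0 0 1 0 0 0 0 (str T)" by (rule D) (simp add: eval)
  have h2: "linear_identity 2 (-1) 0 (str T)" by (rule D) (simp add: eval)
  have h3: "bilinear_identity 2 0 (-1) 0 0 (str T)" by (rule D) (simp add: eval)
  show ?thesis using vector_identity_str[OF h1] linear_identity_str[OF h2] bilinear_identity_str[OF h3]
    by (cases T) (simp_all add: eval_str)
qed

lemma degenerates_C02:
  assumes "degenerates (str C02) (str T)" shows "T \<in> {C02, C05 1, C03, Zero}"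
proof -
  note D = identities_degenerate[OF assms]
  have h1: "vector_identity 0 0 1 0 0 0 0 (str T)" by (rule D) (simp add: eval)
  have h2: "linear_identity 1 (-2) 0 (str T)" by (rule D) (simp add: eval)
  have h3: "bilinear_identity 1 0 (-1) 0 0 (str T)" by (rule D) (simp add: eval)
  show ?thesis using vector_identity_str[OF h1] linear_identity_str[OF h2] bilinear_identity_str[OF h3]
    by (cases T) (simp_all add: eval_str)
qed

lemma degenerates_C03:
  assumes "degenerates (str C03) (str T)" shows "T \<in> {C03, Zero}"
proof -
  note D = identities_degenerate[OF assms]
  have h1: "vector_identity 0 0 1 0 0 0 0 (str T)" by (rule D) (simp add: eval)
  have h2: "linear_identity 1 0 0 (str T)" by (rule D) (simp add: eval)
  have h3: "linear_identity 0 1 0 (str T)" by (rule D) (simp add: eval)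
  show ?thesis using vector_identity_str[OF h1] linear_identity_str[OF h2] linear_identity_str[OF h3]
    by (cases T) (simp_all add: eval_str)
qed

lemma degenerates_C04:
  assumes "degenerates (str C04) (str T)" shows "T \<in> {C04, C03, Zero}"
proof -
  note D = identities_degenerate[OF assms]
  have h1: "vector_identity 0 0 1 0 0 0 0 (str T)" by (rule D) (simp add: eval)
  have h2: "linear_identity 0 1 0 (str T)" by (rule D) (simp add: eval)
  show ?thesis using vector_identity_str[OF h1] linear_identity_str[OF h2]
    by (cases T) (simp_all add: eval_str)
qed

lemma degenerates_C05:
  assumes "degenerates (str (C05 \<alpha>)) (str T)" "\<alpha> \<noteq> 1" shows "T \<in> {C05 \<alpha>, C03, Zero}"
proof -
  note D = identities_degenerate[OF assms(1)]
  have h1: "vector_identity 0 0 1 0 0 0 0 (str T)" by (rule D) (simp add: eval)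
  have h2: "linear_identity 1 (-(1 + \<alpha>)) 0 (str T)" by (rule D) (simp add: eval algebra_simps)
  have h3: "bilinear_identity 1 0 (-1) 0 0 (str T)" by (rule D) (simp add: eval)
  \<comment> \<open>This excludes \<open>C01\<close>, whose trace ratio would force \<alpha> = -1/2.
    There \<open>h3\<close> reads 2 - 4 = 0, in which -1 has been rewritten to 2 \<alpha>.\<close>
  have *: "2 + 8 * \<alpha> \<noteq> 0" if "- 1 = \<alpha> * 2"
  proof
    assume "2 + 8 * \<alpha> = 0"
    with that have "(1::complex) = 0" by algebra
    then show False by simp
  qed
  show ?thesis using vector_identity_str[OF h1] linear_identity_str[OF h2] bilinear_identity_str[OF h3] assms(2)
    by (cases T) (simp_all add: eval_str, metis *)
qed

text \<open>This product is x \<circ> y = trR(x) y. When the trace vanishes the relation kills the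
  product, and this is what rules out \<open>C03\<close>.\<close>

lemma degenerates_C05_1:
  assumes "degenerates (str (C05 1)) (str T)" shows "T \<in> {C05 1, Zero}"
proof -
  note D = identities_degenerate[OF assms(1)]
  have h1: "vector_identity 0 0 1 0 0 0 0 (str T)" by (rule D) (simp add: eval)
  have h2: "vector_identity 1 0 0 0 0 (-1) 0 (str T)" by (rule D) (simp add: eval algebra_simps)
  show ?thesis using vector_identity_str[OF h1] vector_identity_str[OF h2]
    by (cases T) (simp_all add: eval_str)
qed

lemma degenerates_C06:
  assumes "degenerates (str (C06 \<alpha>)) (str T)" "\<alpha> \<noteq> 0" shows "T \<in> {C06 \<alpha>, C03, Zero}"
proof -
  note D = identities_degenerate[OF assms(1)]
  have h1: "vector_identity 0 0 1 0 0 0 0 (str T)" by (rule D) (simp add: eval)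
  have h2: "linear_identity 2 (-(1 + \<alpha>)) 0 (str T)" by (rule D) (simp add: eval algebra_simps)
  have h3: "bilinear_identity 2 0 (-1) 0 0 (str T)" by (rule D) (simp add: eval)
  show ?thesis using vector_identity_str[OF h1] linear_identity_str[OF h2] bilinear_identity_str[OF h3] assms(2)
    by (cases T) (simp_all add: eval_str)
qed

text \<open>Mirror image of the previous case: 2 x \<circ> y = trR(y) x.\<close>

lemma degenerates_C06_0:
  assumes "degenerates (str (C06 0)) (str T)" shows "T \<in> {C06 0, Zero}"
proof -
  note D = identities_degenerate[OF assms(1)]
  have h1: "vector_identity 0 0 1 0 0 0 0 (str T)" by (rule D) (simp add: eval)
  have h2: "vector_identity 2 0 0 0 0 0 (-1) (str T)" by (rule D) (simp add: eval algebra_simps)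
  show ?thesis using vector_identity_str[OF h1] vector_identity_str[OF h2]
    by (cases T) (simp_all add: eval_str)
qed

lemma degenerates_C07:
  assumes "degenerates (str C07) (str T)" shows "T \<in> {C07, C05 0, C06 1, C03, Zero}"
proof -
  note D = identities_degenerate[OF assms]
  have h1: "vector_identity 0 0 1 0 0 0 0 (str T)" by (rule D) (simp add: eval)
  have h2: "vector_identity 1 (-1) 0 0 0 0 0 (str T)" by (rule D) (simp add: eval)
  show ?thesis using vector_identity_str[OF h1] vector_identity_str[OF h2]
    by (cases T) (simp_all add: eval_str)
qed

lemma degenerates_C08:
  assumes "degenerates (str C08) (str T)" shows "T \<in> {C08, C05 (1/2), C06 2, C03, Zero}"
proof -
  note D = identities_degenerate[OF assms]
  have h1: "vector_identity 0 0 1 0 0 0 0 (str T)" by (rule D) (simp add: eval)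
  have h2: "linear_identity 2 (-3) 0 (str T)" by (rule D) (simp add: eval)
  show ?thesis using vector_identity_str[OF h1] linear_identity_str[OF h2]
    by (cases T) (simp_all add: eval_str field_simps)
qed

lemma degenerates_C09:
  assumes "degenerates (str C09) (str T)" shows "T \<in> {C09, C10 0, C12 0, C17 0, Zero}"
proof -
  note D = identities_degenerate[OF assms]
  have h1: "vector_identity 1 0 0 0 0 0 0 (str T)" by (rule D) (simp add: eval)
  show ?thesis using vector_identity_str[OF h1]
    by (cases T) (simp_all add: eval_str)
qed

text \<open>Half the trace of the first product is the character \<epsilon> of the local algebra
  with unit \<open>e1\<close>, and x \<circ> y = \<alpha> (x \<cdot> y - \<epsilon>(y) x). Where the
  trace vanishes this is \<alpha> x \<cdot> y, hence the limit \<open>C17 \<alpha>\<close>. The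
  second identity is multiplicativity of \<epsilon>.\<close>

lemma degenerates_C10:
  assumes "degenerates (str (C10 \<alpha>)) (str T)" shows "T \<in> {C10 \<alpha>, C17 \<alpha>, Zero}"
proof -
  note D = identities_degenerate[OF assms]
  have h1: "vector_identity (-2) 0 (2 * \<alpha>) 0 (- \<alpha>) 0 0 (str T)" by (rule D) (simp add: eval algebra_simps)
  have h2: "bilinear_identity 0 0 0 2 (-1) (str T)" by (rule D) (simp add: eval algebra_simps)
  show ?thesis using vector_identity_str[OF h1] bilinear_identity_str[OF h2]
    by (cases T) (simp_all add: eval_str)
qed

text \<open>As for \<open>C10 \<alpha>\<close>, half the trace of the first product is
  multiplicative; on \<open>C12 \<alpha>\<close> and \<open>C13\<close> the trace itself is. This
  factor separates the limits \<open>C10 0\<close> and \<open>C12 0\<close>.\<close>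

lemma degenerates_C11:
  assumes "degenerates (str C11) (str T)"
  shows "T \<in> {C11, C05 0, C10 0, C03, Zero} \<union> range C17"
proof -
  note D = identities_degenerate[OF assms]
  have h1: "vector_identity 1 (-1) 0 0 0 0 0 (str T)" by (rule D) (simp add: eval)
  have h2: "bilinear_identity 0 0 0 2 (-1) (str T)" by (rule D) (simp add: eval algebra_simps)
  have h3: "bilinear_identity 1 0 (-1) 0 0 (str T)" by (rule D) (simp add: eval)
  show ?thesis using vector_identity_str[OF h1] bilinear_identity_str[OF h2] bilinear_identity_str[OF h3]
    by (cases T) (simp_all add: eval_str)
qed

text \<open>With \<tau> the trace form of the first product, x \<circ> y = \<alpha> (\<tau>(x) y - x
  \<cdot> y). At vanishing trace only - \<alpha> x \<cdot> y is left, which explains the sign in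
  \<open>C17 (- \<alpha>)\<close>.\<close>

lemma degenerates_C12:
  assumes "degenerates (str (C12 \<alpha>)) (str T)" shows "T \<in> {C12 \<alpha>, C17 (- \<alpha>), Zero}"
proof -
  note D = identities_degenerate[OF assms]
  have h1: "vector_identity 1 0 \<alpha> (- \<alpha>) 0 0 0 (str T)" by (rule D) (simp add: eval algebra_simps)
  have h2: "bilinear_identity 0 0 0 1 (-1) (str T)" by (rule D) (simp add: eval algebra_simps)
  show ?thesis using vector_identity_str[OF h1] bilinear_identity_str[OF h2]
    by (cases T) (simp_all add: eval_str eq_neg_iff_add_eq_0 add.commute)
qed

lemma degenerates_C13:
  assumes "degenerates (str C13) (str T)"
  shows "T \<in> {C13, C05 0, C12 0, C03, Zero} \<union> range C17"
proof -
  note D = identities_degenerate[OF assms]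
  have h1: "vector_identity 1 (-1) 0 0 0 0 0 (str T)" by (rule D) (simp add: eval)
  have h2: "bilinear_identity 0 0 0 1 (-1) (str T)" by (rule D) (simp add: eval algebra_simps)
  have h3: "bilinear_identity 1 0 (-1) 0 0 (str T)" by (rule D) (simp add: eval)
  show ?thesis using vector_identity_str[OF h1] bilinear_identity_str[OF h2] bilinear_identity_str[OF h3]
    by (cases T) (simp_all add: eval_str)
qed

lemma degenerates_C14:
  assumes "degenerates (str C14) (str T)"
  shows "T \<in> {C14, C05 2, C03, Zero} \<union> range C17"
proof -
  note D = identities_degenerate[OF assms]
  have h1: "linear_identity 0 0 1 (str T)" by (rule D) (simp add: eval)
  have h2: "linear_identity 1 (-3) 0 (str T)" by (rule D) (simp add: eval)
  have h3: "bilinear_identity 1 0 (-1) 0 0 (str T)" by (rule D) (simp add: eval)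
  show ?thesis using linear_identity_str[OF h1] linear_identity_str[OF h2] bilinear_identity_str[OF h3]
    by (cases T) (simp_all add: eval_str)
qed

text \<open>The value at (e1, e1) determines the coefficient of trR(x \<cdot> y): 2 \<gamma>^2 + 2 c
  = 4 \<gamma>^2. Only \<gamma>^2 enters, in accordance with the isomorphism between
  \<open>C15 \<gamma>\<close> and \<open>C15 (- \<gamma>)\<close>.\<close>

lemma degenerates_C15:
  assumes "degenerates (str (C15 \<gamma>)) (str T)"
  shows "T \<in> {C15 \<gamma>, C15 (- \<gamma>), C05 (1/2), C03, Zero} \<union> range C17"
proof -
  note D = identities_degenerate[OF assms]
  have h1: "linear_identity 0 0 1 (str T)" by (rule D) (simp add: eval)
  have h2: "linear_identity 2 (-3) 0 (str T)" by (rule D) (simp add: eval algebra_simps)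
  have h3: "bilinear_identity 1 (\<gamma> * \<gamma>) (-1) 0 0 (str T)" by (rule D) (simp add: eval algebra_simps)
  show ?thesis using linear_identity_str[OF h1] linear_identity_str[OF h2] bilinear_identity_str[OF h3]
    by (cases T) (simp_all add: eval_str field_simps square_eq_iff, auto)
qed

text \<open>The trace ratio 3/2 is shared with \<open>C15 \<gamma>\<close>, \<open>C08\<close> and
  \<open>C05 (1/2)\<close>; the factor 2 in the third identity excludes these.\<close>

lemma degenerates_C16:
  assumes "degenerates (str C16) (str T)"
  shows "T \<in> {C16, C06 2, C03, Zero} \<union> range C17"
proof -
  note D = identities_degenerate[OF assms]
  have h1: "linear_identity 0 0 1 (str T)" by (rule D) (simp add: eval)
  have h2: "linear_identity 2 (-3) 0 (str T)" by (rule D) (simp add: eval)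
  have h3: "bilinear_identity 2 0 (-1) 0 0 (str T)" by (rule D) (simp add: eval)
  show ?thesis using linear_identity_str[OF h1] linear_identity_str[OF h2] bilinear_identity_str[OF h3]
    by (cases T) (simp_all add: eval_str)
qed

lemma degenerates_C17:
  assumes "degenerates (str (C17 \<beta>)) (str T)" shows "T \<in> {C17 \<beta>, Zero}"
proof -
  note D = identities_degenerate[OF assms]
  have h1: "linear_identity 0 0 1 (str T)" by (rule D) (simp add: eval)
  have h2: "vector_identity 1 0 (- \<beta>) 0 0 0 0 (str T)" by (rule D) (simp add: eval algebra_simps)
  show ?thesis using linear_identity_str[OF h1] vector_identity_str[OF h2]
    by (cases T) (simp_all add: eval_str)
qed

lemma degenerates_Zero:
  assumes "degenerates (str Zero) (str T)" shows "T = Zero"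
proof -
  note D = identities_degenerate[OF assms]
  have h1: "vector_identity 1 0 0 0 0 0 0 (str T)" by (rule D) (simp add: eval)
  have h2: "vector_identity 0 0 1 0 0 0 0 (str T)" by (rule D) (simp add: eval)
  show ?thesis using vector_identity_str[OF h1] vector_identity_str[OF h2]
    by (cases T) (simp_all add: eval_str)
qed

section \<open>Polynomials in the entries of a matrix\<close>

interpretation fs: vector_space "\<lambda>(c::complex) (f :: 'a \<Rightarrow> complex) x. c * f x"
  by standard (auto simp: fun_eq_iff algebra_simps)

lemma sum_fun_apply: "(\<Sum>i\<in>I. f i) x = (\<Sum>i\<in>I. (f i x :: complex))"
  by (induction I rule: infinite_finite_induct) auto

text \<open>The Steinitz bound for an indexed family. A coincidence h i = h j would itself be a
  relation, so independence of the family includes injectivity.\<close>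

lemma card_le_of_independent:
  assumes I: "finite I" and B: "finite B" and sp: "\<And>i. i \<in> I \<Longrightarrow> h i \<in> fs.span B"
    and indep: "\<And>c. (\<And>x. (\<Sum>i\<in>I. c i * h i x) = 0) \<Longrightarrow> \<forall>i\<in>I. c i = 0"
  shows "card I \<le> card B"
proof -
  have inj: "inj_on h I"
  proof (rule inj_onI, rule ccontr)
    fix i j assume ij: "i \<in> I" "j \<in> I" "h i = h j" "i \<noteq> j"
    let ?c = "\<lambda>k. if k = i then 1 else if k = j then - 1 else (0::complex)"
    have "(\<Sum>k\<in>I. ?c k * h k x) = 0" for x
    proof -
      have "(\<Sum>k\<in>I. ?c k * h k x) = (\<Sum>k\<in>{i, j}. ?c k * h k x)"
        using ij I by (intro sum.mono_neutral_right) auto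
      then show ?thesis using ij by simp
    qed
    from indep[of ?c, OF this] ij show False by auto
  qed
  have "fs.independent (h ` I)"
    unfolding fs.dependent_finite[OF finite_imageI[OF I]]
  proof
    assume "\<exists>u. (\<exists>v\<in>h ` I. u v \<noteq> 0) \<and> (\<Sum>v\<in>h ` I. (\<lambda>x. u v * v x)) = 0"
    then obtain u i where i: "i \<in> I" "u (h i) \<noteq> 0" and z: "(\<Sum>v\<in>h ` I. (\<lambda>x. u v * v x)) = 0" by auto
    have "(\<Sum>i\<in>I. u (h i) * h i x) = 0" for x
      using fun_cong[OF z, of x] by (simp add: sum_fun_apply sum.reindex[OF inj])
    from indep[of "\<lambda>i. u (h i)", OF this] i show False by auto
  qed
  from fs.independent_span_bound[OF B this] sp have "card (h ` I) \<le> card B" by auto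
  then show ?thesis by (simp add: card_image[OF inj])
qed

type_synonym exps = "nat \<times> nat \<times> nat \<times> nat"

fun entry_mon :: "exps \<Rightarrow> V \<times> V \<Rightarrow> complex" where
  "entry_mon (i, j, k, l) (u, v) = (u $ 1) ^ i * (u $ 2) ^ j * (v $ 1) ^ k * (v $ 2) ^ l"

text \<open>Each exponent is bounded separately, not the total degree, so that fixing some entries
  of the matrix leaves exactly a power of K + 1 monomials.\<close>

definition exponents :: "nat \<Rightarrow> exps set" where
  "exponents K = {..K} \<times> {..K} \<times> {..K} \<times> {..K}"

definition entry_poly :: "nat \<Rightarrow> (V \<times> V \<Rightarrow> complex) set" where
  "entry_poly K = fs.span (entry_mon ` exponents K)"

lemma entry_poly_mono: "h \<in> entry_poly K \<Longrightarrow> K \<le> L \<Longrightarrow> h \<in> entry_poly L"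
  unfolding entry_poly_def by (erule rev_subsetD, rule fs.span_mono) (auto simp: exponents_def)

lemma entry_poly_mon: "e \<in> exponents K \<Longrightarrow> entry_mon e \<in> entry_poly K"
  unfolding entry_poly_def by (auto intro: fs.span_base)

lemma entry_poly_scale: "h \<in> entry_poly K \<Longrightarrow> (\<lambda>w. c * h w) \<in> entry_poly K"
  unfolding entry_poly_def by (rule fs.span_scale)

lemma entry_poly_add: "h \<in> entry_poly K \<Longrightarrow> h' \<in> entry_poly K \<Longrightarrow> (\<lambda>w. h w + h' w) \<in> entry_poly K"
  using fs.span_add[of h "entry_mon ` exponents K" h'] unfolding entry_poly_def plus_fun_def by simp

lemma entry_poly_diff: "h \<in> entry_poly K \<Longrightarrow> h' \<in> entry_poly K \<Longrightarrow> (\<lambda>w. h w - h' w) \<in> entry_poly K"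
  using entry_poly_add[OF _ entry_poly_scale[of h' K "-1"], of h] by simp

lemma entry_poly_const: "(\<lambda>_. c) \<in> entry_poly K"
proof -
  have "entry_mon (0, 0, 0, 0) = (\<lambda>_. 1)" by (simp add: fun_eq_iff)
  then show ?thesis using entry_poly_scale[OF entry_poly_mon[of "(0, 0, 0, 0)" K], of c] by (simp add: exponents_def)
qed

lemma entry_poly_mult:
  assumes "h \<in> entry_poly K" "h' \<in> entry_poly L" shows "(\<lambda>w. h w * h' w) \<in> entry_poly (K + L)"
proof -
  have mm: "(\<lambda>w. entry_mon e w * entry_mon e' w) \<in> entry_poly (K + L)" if "e \<in> exponents K" "e' \<in> exponents L" for e e'
  proof -
    obtain i j k l i' j' k' l' where e: "e = (i, j, k, l)" "e' = (i', j', k', l')"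
      by (metis prod_cases4)
    have "(\<lambda>w. entry_mon e w * entry_mon e' w) = entry_mon (i + i', j + j', k + k', l + l')"
      unfolding e by (auto simp: fun_eq_iff power_add)
    also have "\<dots> \<in> entry_poly (K + L)" using that by (intro entry_poly_mon) (auto simp: e exponents_def)
    finally show ?thesis .
  qed
  have mh: "(\<lambda>w. entry_mon e w * h' w) \<in> entry_poly (K + L)" if "e \<in> exponents K" for e
    using assms(2) unfolding entry_poly_def[of L]
  proof (induction rule: fs.span_induct_alt)
    case base
    show ?case using entry_poly_const[of 0] by simp
  next
    case (step c x y)
    then obtain e' where e': "e' \<in> exponents L" "x = entry_mon e'" by auto
    from entry_poly_add[OF entry_poly_scale[OF mm[OF that e'(1)], of c] step(2)]
    show ?case by (simp add: e' algebra_simps)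
  qed
  show ?thesis using assms(1) unfolding entry_poly_def[of K]
  proof (induction rule: fs.span_induct_alt)
    case base
    show ?case using entry_poly_const[of 0] by simp
  next
    case (step c x y)
    then obtain e where e: "e \<in> exponents K" "x = entry_mon e" by auto
    from entry_poly_add[OF entry_poly_scale[OF mh[OF e(1)], of c] step(2)]
    show ?case by (simp add: e algebra_simps)
  qed
qed

lemma entry_poly_entry: "(\<lambda>w. fst w $ i) \<in> entry_poly 1" "(\<lambda>w. snd w $ i) \<in> entry_poly 1"
proof -
  have "(\<lambda>w. fst w $ 1) = entry_mon (1, 0, 0, 0)" "(\<lambda>w. fst w $ 2) = entry_mon (0, 1, 0, 0)"
    "(\<lambda>w. snd w $ 1) = entry_mon (0, 0, 1, 0)" "(\<lambda>w. snd w $ 2) = entry_mon (0, 0, 0, 1)"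
    by (auto simp: fun_eq_iff)
  then show "(\<lambda>w. fst w $ i) \<in> entry_poly 1" "(\<lambda>w. snd w $ i) \<in> entry_poly 1"
    using exhaust_2[of i] entry_poly_mon[of "(1, 0, 0, 0)" 1] entry_poly_mon[of "(0, 1, 0, 0)" 1]
      entry_poly_mon[of "(0, 0, 1, 0)" 1] entry_poly_mon[of "(0, 0, 0, 1)" 1]
    by (auto simp: exponents_def)
qed

abbreviation wdet :: "V \<times> V \<Rightarrow> complex" where "wdet w \<equiv> det2 (fst w) (snd w)"

lemma entry_poly_det: "wdet \<in> entry_poly 2"
  unfolding det2_def using entry_poly_diff[OF entry_poly_mult entry_poly_mult, OF entry_poly_entry(1) entry_poly_entry(2) entry_poly_entry(1) entry_poly_entry(2)]
  by (simp add: numeral_2_eq_2)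

lemma entry_poly_det_power: "(\<lambda>w. wdet w ^ n) \<in> entry_poly (2 * n)"
proof (induction n)
  case 0
  show ?case using entry_poly_const[of 1] by simp
next
  case (Suc n)
  from entry_poly_mult[OF entry_poly_det Suc] show ?case by simp
qed

definition line :: "V \<times> V \<Rightarrow> V \<times> V \<Rightarrow> complex \<Rightarrow> V \<times> V" where
  "line w w' t = ((1 - t) *s fst w + t *s fst w', (1 - t) *s snd w + t *s snd w')"

text \<open>Each entry is an affine function of the parameter of the line.\<close>

lemma entry_poly_line:
  assumes "h \<in> entry_poly K" shows "\<exists>q. \<forall>t. h (line w w' t) = poly q t"
  using assms unfolding entry_poly_def
proof (induction rule: fs.span_induct_alt)
  case base
  show ?case by (intro exI[of _ 0]) simp
next
  case (step c x y)
  obtain i j k l where x: "x = entry_mon (i, j, k, l)" using step(1) by auto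
  let ?p = "\<lambda>a b :: complex. [:a, b - a:]"
  have "x (line w w' t) = poly (?p (fst w $ 1) (fst w' $ 1) ^ i * ?p (fst w $ 2) (fst w' $ 2) ^ j *
     ?p (snd w $ 1) (snd w' $ 1) ^ k * ?p (snd w $ 2) (snd w' $ 2) ^ l) t" for t
    by (simp add: x line_def poly_power algebra_simps)
  moreover obtain q where "\<forall>t. y (line w w' t) = poly q t" using step(2) by blast
  ultimately show ?case
    by (intro exI[of _ "smult c (?p (fst w $ 1) (fst w' $ 1) ^ i * ?p (fst w $ 2) (fst w' $ 2) ^ j *
     ?p (snd w $ 1) (snd w' $ 1) ^ k * ?p (snd w $ 2) (snd w' $ 2) ^ l) + q"]) simp
qed

text \<open>The invertible matrices in an affine subspace of the space of matrices.\<close>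
definition affine_part :: "(V \<times> V) set \<Rightarrow> bool" where
  "affine_part A \<longleftrightarrow> (\<forall>w\<in>A. wdet w \<noteq> 0) \<and>
     (\<forall>w\<in>A. \<forall>w'\<in>A. \<forall>t. wdet (line w w' t) \<noteq> 0 \<longrightarrow> line w w' t \<in> A)"

text \<open>On the line joining a point where \<open>h \<noteq> 0\<close> to one where \<open>h' \<noteq> 0\<close>, the functions \<open>h\<close>, \<open>h'\<close> and
  the determinant are nonzero univariate polynomials, hence have a common nonzero.\<close>
lemma affine_part_irreducible:
  assumes A: "affine_part A" and h: "h \<in> entry_poly K" "h' \<in> entry_poly L"
    and z: "\<And>w. w \<in> A \<Longrightarrow> h w = 0 \<or> h' w = 0"
  shows "(\<forall>w\<in>A. h w = 0) \<or> (\<forall>w\<in>A. h' w = 0)"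
proof (rule ccontr)
  assume "\<not> ?thesis"
  then obtain w w' where w: "w \<in> A" "h w \<noteq> 0" "w' \<in> A" "h' w' \<noteq> 0" by auto
  obtain p q d where p: "\<And>t. h (line w w' t) = poly p t" and q: "\<And>t. h' (line w w' t) = poly q t"
    and d: "\<And>t. wdet (line w w' t) = poly d t"
    using entry_poly_line[OF h(1)] entry_poly_line[OF h(2)] entry_poly_line[OF entry_poly_det] by metis
  have l: "line w w' 0 = w" "line w w' 1 = w'" by (simp_all add: line_def)
  have "poly p 0 \<noteq> 0" "poly q 1 \<noteq> 0" "poly d 0 \<noteq> 0"
    using w A by (auto simp flip: p q d simp: l affine_part_def)
  then have "p * q * d \<noteq> 0" by auto
  then obtain t where "poly (p * q * d) t \<noteq> 0" using poly_all_0_iff_0 by blast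
  then have t: "poly p t \<noteq> 0" "poly q t \<noteq> 0" "poly d t \<noteq> 0" by auto
  then have "line w w' t \<in> A" using w A d by (auto simp: affine_part_def)
  from z[OF this] t show False by (simp add: p q)
qed

section \<open>Pulling back polynomial functions to the group\<close>

text \<open>The determinant to the power \<open>D\<close> clears the denominators of \<open>f\<close> on the orbit of \<open>T\<close>; the
  degree of the resulting polynomial is bounded by the same \<open>D\<close>.\<close>
definition pole_order :: "bilpair \<Rightarrow> nat \<Rightarrow> (bilpair \<Rightarrow> complex) \<Rightarrow> bool" where
  "pole_order T D f \<longleftrightarrow> (\<exists>h\<in>entry_poly (2 * D). \<forall>u v. det2 u v \<noteq> 0 \<longrightarrow> f (act (lin u v) T) * det2 u v ^ D = h (u, v))"

lemma pole_order_const: "pole_order T 0 (\<lambda>_. c)"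
  unfolding pole_order_def by (rule bexI[of _ "\<lambda>_. c"]) (auto intro: entry_poly_const)

lemma pole_order_mono: assumes "pole_order T D f" "D \<le> E" shows "pole_order T E f"
proof -
  obtain h where h: "h \<in> entry_poly (2 * D)"
     "\<And>u v. det2 u v \<noteq> 0 \<Longrightarrow> f (act (lin u v) T) * det2 u v ^ D = h (u, v)"
    using assms by (auto simp: pole_order_def)
  obtain n where n: "E = D + n" using assms(2) le_Suc_ex by blast
  show ?thesis unfolding pole_order_def
    by (rule bexI[OF _ entry_poly_mult[OF h(1) entry_poly_det_power[of n], THEN entry_poly_mono]])
       (auto simp: n power_add simp flip: h(2))
qed

lemma pole_order_mult: assumes "pole_order T D f" "pole_order T E g" shows "pole_order T (D + E) (\<lambda>S. f S * g S)"
proof -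
  obtain h where h: "h \<in> entry_poly (2 * D)"
     "\<And>u v. det2 u v \<noteq> 0 \<Longrightarrow> f (act (lin u v) T) * det2 u v ^ D = h (u, v)"
    using assms by (auto simp: pole_order_def)
  obtain h' where h': "h' \<in> entry_poly (2 * E)"
     "\<And>u v. det2 u v \<noteq> 0 \<Longrightarrow> g (act (lin u v) T) * det2 u v ^ E = h' (u, v)"
    using assms by (auto simp: pole_order_def)
  show ?thesis unfolding pole_order_def
    by (rule bexI[OF _ entry_poly_mult[OF h(1) h'(1), THEN entry_poly_mono]])
       (auto simp: power_add algebra_simps simp flip: h(2) h'(2))
qed

lemma pole_order_add: assumes "pole_order T D f" "pole_order T E g" shows "pole_order T (D + E) (\<lambda>S. f S + g S)"
proof -
  obtain h where h: "h \<in> entry_poly (2 * (D + E))"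
     "\<And>u v. det2 u v \<noteq> 0 \<Longrightarrow> f (act (lin u v) T) * det2 u v ^ (D + E) = h (u, v)"
    using pole_order_mono[OF assms(1), of "D + E"] by (auto simp: pole_order_def)
  obtain h' where h': "h' \<in> entry_poly (2 * (D + E))"
     "\<And>u v. det2 u v \<noteq> 0 \<Longrightarrow> g (act (lin u v) T) * det2 u v ^ (D + E) = h' (u, v)"
    using pole_order_mono[OF assms(2), of "D + E"] by (auto simp: pole_order_def)
  show ?thesis unfolding pole_order_def
    by (rule bexI[OF _ entry_poly_add[OF h(1) h'(1)]]) (auto simp: distrib_right simp flip: h(2) h'(2))
qed

lemma entry_poly_adj: "(\<lambda>w. adj (fst w) (snd w) x $ k) \<in> entry_poly 1"
  using exhaust_2[of k] entry_poly_diff[OF entry_poly_scale[OF entry_poly_entry(1)[of 1], of "x $ 2"] entry_poly_scale[OF entry_poly_entry(1)[of 2], of "x $ 1"]]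
    entry_poly_diff[OF entry_poly_scale[OF entry_poly_entry(2)[of 2], of "x $ 1"] entry_poly_scale[OF entry_poly_entry(2)[of 1], of "x $ 2"]]
  by (auto simp: adj_nth mult.commute)

lemma entry_poly_bil_adj: "(\<lambda>w. bil a b c d (adj (fst w) (snd w) x) (adj (fst w) (snd w) y) $ k) \<in> entry_poly 2"
proof -
  have *: "(\<lambda>w. adj (fst w) (snd w) x $ i * adj (fst w) (snd w) y $ j * z) \<in> entry_poly 2" for i j z
    using entry_poly_scale[OF entry_poly_mult[OF entry_poly_adj[of x i] entry_poly_adj[of y j]], of z]
    by (simp add: mult.commute numeral_2_eq_2)
  show ?thesis unfolding bil_nth by (intro entry_poly_add *)
qed

lemma act_bil_det:
  assumes "det2 u v \<noteq> 0"
  shows "lin u v (bil a b c d (linv u v x) (linv u v y)) $ k * (det2 u v)\<^sup>2 =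
     lin u v (bil a b c d (adj u v x) (adj u v y)) $ k"
proof -
  have "lin u v (bil a b c d (linv u v x) (linv u v y)) $ k =
     lin u v (bil a b c d (adj u v x) (adj u v y)) $ k / (det2 u v)\<^sup>2"
    by (simp add: lin_nth bil_nth linv_nth power2_eq_square add_divide_distrib algebra_simps)
  with assms show ?thesis by simp
qed

text \<open>A structure constant is quadratic in the inverse, so two factors of the determinant
  clear it. The numerator is cubic in the entries and fits into the bound 4 = 2 * 2.\<close>

lemma pole_order_coord:
  assumes "T \<in> Bil2"
  shows "pole_order T 2 (\<lambda>S. fst S x y $ k)" "pole_order T 2 (\<lambda>S. snd S x y $ k)"
proof -
  have entry_poly: "(\<lambda>w. lin (fst w) (snd w) (bil a b c d (adj (fst w) (snd w) x) (adj (fst w) (snd w) y)) $ k) \<in> entry_poly 4"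
    for a b c d unfolding lin_nth
    using entry_poly_add[OF entry_poly_mult[OF entry_poly_bil_adj entry_poly_entry(1)] entry_poly_mult[OF entry_poly_bil_adj entry_poly_entry(2)]]
    by (rule entry_poly_mono) simp
  have T: "fst T = bil (fst T e1 e1) (fst T e1 e2) (fst T e2 e1) (fst T e2 e2)"
    "snd T = bil (snd T e1 e1) (snd T e1 e2) (snd T e2 e1) (snd T e2 e2)"
    using assms cbilinear_eq_bil by (auto simp: Bil2_def)
  show "pole_order T 2 (\<lambda>S. fst S x y $ k)" unfolding pole_order_def
    by (rule bexI[OF _ entry_poly[of "fst T e1 e1" "fst T e1 e2" "fst T e2 e1" "fst T e2 e2", folded T, THEN entry_poly_mono]])
       (auto simp: act_lin act_bil_det[of _ _ "fst T e1 e1" "fst T e1 e2" "fst T e2 e1" "fst T e2 e2", folded T])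
  show "pole_order T 2 (\<lambda>S. snd S x y $ k)" unfolding pole_order_def
    by (rule bexI[OF _ entry_poly[of "snd T e1 e1" "snd T e1 e2" "snd T e2 e1" "snd T e2 e2", folded T, THEN entry_poly_mono]])
       (auto simp: act_lin act_bil_det[of _ _ "snd T e1 e1" "snd T e1 e2" "snd T e2 e1" "snd T e2 e2", folded T])
qed

lemma polyfun_pole_order: "polyfun f \<Longrightarrow> T \<in> Bil2 \<Longrightarrow> \<exists>D. pole_order T D f"
proof (induction rule: polyfun.induct)
  case (add f g)
  then show ?case using pole_order_add by meson
next
  case (mult f g)
  then show ?case using pole_order_mult by meson
qed (use pole_order_const pole_order_coord in blast)+

lemma polyfun_pullback:
  assumes "polyfun f" "T \<in> Bil2"
  obtains K h where "h \<in> entry_poly K" "\<And>u v. det2 u v \<noteq> 0 \<Longrightarrow> f (act (lin u v) T) = 0 \<longleftrightarrow> h (u, v) = 0"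
proof -
  obtain D where "pole_order T D f" using polyfun_pole_order[OF assms] by blast
  then obtain h where h: "h \<in> entry_poly (2 * D)"
     "\<And>u v. det2 u v \<noteq> 0 \<Longrightarrow> f (act (lin u v) T) * det2 u v ^ D = h (u, v)"
    by (auto simp: pole_order_def)
  from this(1) show thesis by (rule that) (simp flip: h(2))
qed

section \<open>Upper bound for the dimension\<close>

lemma polyfun_power: "polyfun f \<Longrightarrow> polyfun (\<lambda>S. f S ^ n)"
  by (induction n) (auto intro: polyfun.intros)

lemma polyfun_sum: "(\<And>i. i \<in> I \<Longrightarrow> polyfun (f i)) \<Longrightarrow> polyfun (\<lambda>S. \<Sum>i\<in>I. f i S)"
  by (induction I rule: infinite_finite_induct) (auto intro: polyfun.intros)

lemma polyfun_cmult: "polyfun f \<Longrightarrow> polyfun (\<lambda>S. c * f S)"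
  by (rule polyfun.mult[OF polyfun.const])

fun list_mon :: "(bilpair \<Rightarrow> complex) list \<Rightarrow> nat list \<Rightarrow> bilpair \<Rightarrow> complex" where
  "list_mon (f # fs) (k # ks) S = f S ^ k * list_mon fs ks S"
| "list_mon _ _ S = 1"

lemma list_mon_Nil: "list_mon [] ks = (\<lambda>_. 1)" "list_mon fs [] = (\<lambda>_. 1)"
  by (auto simp: fun_eq_iff elim: list_mon.elims)

lemma polyfun_list_mon: "\<forall>f\<in>set fs. polyfun f \<Longrightarrow> polyfun (list_mon fs ks)"
proof (induction fs ks rule: list_induct2')
  case (4 f fs k ks)
  then have "polyfun (\<lambda>S. f S ^ k * list_mon fs ks S)"
    by (intro polyfun.mult polyfun_power) auto
  then show ?case by simp
qed (auto simp: list_mon_Nil intro: polyfun.const)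

text \<open>The exponent vectors of the monomials in n functions; the strict bound makes their
  number exactly N ^ n.\<close>

definition exp_lists :: "nat \<Rightarrow> nat \<Rightarrow> nat list set" where
  "exp_lists n N = {ks. length ks = n \<and> set ks \<subseteq> {..<N}}"

lemma exp_lists_0: "exp_lists 0 N = {[]}" by (auto simp: exp_lists_def)

lemma exp_lists_Suc: "exp_lists (Suc n) N = (\<lambda>(k, ks). k # ks) ` ({..<N} \<times> exp_lists n N)"
  by (auto simp: exp_lists_def length_Suc_conv image_iff)

lemma finite_exp_lists: "finite (exp_lists n N)"
  unfolding exp_lists_def using finite_lists_length_eq[of "{..<N}" n] by (simp add: conj_commute)

lemma card_exp_lists: "card (exp_lists n N) = N ^ n"
  unfolding exp_lists_def using card_lists_length_eq[of "{..<N}" n] by (simp add: conj_commute)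

lemma sum_exp_lists_Suc: "(\<Sum>ks\<in>exp_lists (Suc n) N. g ks) = (\<Sum>k<N. \<Sum>ks\<in>exp_lists n N. g (k # ks))"
proof -
  have "inj_on (\<lambda>(k, ks). k # ks) ({..<N} \<times> exp_lists n N)" by (auto simp: inj_on_def)
  then show ?thesis
    unfolding exp_lists_Suc by (simp add: sum.reindex sum.cartesian_product split_def)
qed

definition alg_indep :: "(bilpair \<Rightarrow> complex) list \<Rightarrow> bilpair set \<Rightarrow> bool" where
  "alg_indep fs Z \<longleftrightarrow> (\<forall>N c. (\<forall>S\<in>Z. (\<Sum>ks\<in>exp_lists (length fs) N. c ks * list_mon fs ks S) = 0) \<longrightarrow>
     (\<forall>ks\<in>exp_lists (length fs) N. c ks = 0))"

lemma alg_indepD: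
  assumes "alg_indep fs Z" "\<And>S. S \<in> Z \<Longrightarrow> (\<Sum>ks\<in>exp_lists (length fs) N. c ks * list_mon fs ks S) = 0"
    "ks \<in> exp_lists (length fs) N"
  shows "c ks = 0"
  using assms unfolding alg_indep_def by blast

lemma closedin_orbit_zariski:
  assumes "Q \<subseteq> Bil2" "polyfun f"
  shows "closedin (subtopology zariski Q) {S \<in> Q. f S = 0}"
proof -
  have "closedin zariski (zero_locus {f})" using assms(2) by (auto simp: closedin_zariski)
  moreover have "{S \<in> Q. f S = 0} = zero_locus {f} \<inter> Q" using assms(1) by (auto simp: zero_locus_def)
  ultimately show ?thesis by (auto simp: closedin_subtopology)
qed

lemma irreducible_inD:
  "irreducible_in X Z \<Longrightarrow> closedin X A \<Longrightarrow> closedin X B \<Longrightarrow> Z \<subseteq> A \<union> B \<Longrightarrow> Z \<subseteq> A \<or> Z \<subseteq> B"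
  by (simp add: irreducible_in_def)

lemma not_in_zero_locus:
  "x \<in> Q \<Longrightarrow> Q \<subseteq> Bil2 \<Longrightarrow> x \<notin> zero_locus F \<inter> Q \<Longrightarrow> \<exists>f\<in>F. f x \<noteq> 0"
  by (auto simp: zero_locus_def)

text \<open>The polynomial functions on an irreducible set form an integral domain.\<close>

lemma irreducible_cancel:
  assumes irr: "irreducible_in (subtopology zariski Q) Z" and Q: "Q \<subseteq> Bil2"
    and f: "polyfun f" "s \<in> Z" "f s \<noteq> 0" and g: "polyfun g"
    and z: "\<And>S. S \<in> Z \<Longrightarrow> f S * g S = 0" and S: "S \<in> Z"
  shows "g S = 0"
proof -
  have "Z \<subseteq> Q" using irr by (simp add: irreducible_in_def)
  with z have "Z \<subseteq> {S \<in> Q. f S = 0} \<union> {S \<in> Q. g S = 0}" by auto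
  then have "Z \<subseteq> {S \<in> Q. f S = 0} \<or> Z \<subseteq> {S \<in> Q. g S = 0}"
    by (rule irreducible_inD[OF irr closedin_orbit_zariski[OF Q f(1)] closedin_orbit_zariski[OF Q g]])
  with f S show ?thesis by auto
qed

text \<open>In a relation \<open>\<Sum>k. f ^ k * A k = 0\<close> on \<open>Z'\<close> the lowest power of \<open>f\<close> cancels by irreducibility;
  restricting to \<open>Z\<close>, where \<open>f\<close> vanishes, then leaves its coefficient.\<close>
lemma alg_indep_Cons:
  assumes fs: "alg_indep fs Z" "\<forall>g\<in>set fs. polyfun g" and f: "polyfun f" "\<And>S. S \<in> Z \<Longrightarrow> f S = 0"
    and Z': "Z \<subseteq> Z'" "irreducible_in (subtopology zariski Q) Z'" "Q \<subseteq> Bil2"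
    and s: "s \<in> Z'" "f s \<noteq> 0"
  shows "alg_indep (f # fs) Z'"
  unfolding alg_indep_def
proof (intro allI impI)
  fix N and c :: "nat list \<Rightarrow> complex"
  define A where "A = (\<lambda>k S. \<Sum>ks\<in>exp_lists (length fs) N. c (k # ks) * list_mon fs ks S)"
  assume "\<forall>S\<in>Z'. (\<Sum>ks\<in>exp_lists (length (f # fs)) N. c ks * list_mon (f # fs) ks S) = 0"
  then have z: "(\<Sum>k<N. f S ^ k * A k S) = 0" if "S \<in> Z'" for S
    using that by (simp add: sum_exp_lists_Suc A_def sum_distrib_left mult.left_commute)
  have pA: "polyfun (A k)" for k
    unfolding A_def by (intro polyfun_sum polyfun_cmult polyfun_list_mon fs)
  have "\<forall>ks\<in>exp_lists (length fs) N. c (k # ks) = 0" if "k < N" for k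
    using that
  proof (induction k rule: less_induct)
    case (less k)
    have A0: "A j S = 0" if "j < k" for j S
      using less.IH[OF that] less.prems that unfolding A_def by (intro sum.neutral) auto
    define g where "g = (\<lambda>S. \<Sum>j\<in>{k..<N}. f S ^ (j - k) * A j S)"
    have pg: "polyfun g"
      unfolding g_def by (intro polyfun_sum polyfun.mult polyfun_power f pA)
    have "f S ^ k * g S = 0" if "S \<in> Z'" for S
    proof -
      have "(\<Sum>j<N. f S ^ j * A j S) = (\<Sum>j\<in>{k..<N}. f S ^ j * A j S)"
        by (rule sum.mono_neutral_right) (auto simp: A0)
      also have "\<dots> = f S ^ k * g S"
        unfolding g_def sum_distrib_left
        by (intro sum.cong) (auto simp flip: mult.assoc power_add)
      finally show ?thesis using z[OF that] by simp
    qed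
    from irreducible_cancel[OF Z'(2,3) polyfun_power[OF f(1)] s(1) _ pg this] s(2)
    have g0: "g S = 0" if "S \<in> Z'" for S using that by auto
    have "A k S = 0" if "S \<in> Z" for S
    proof -
      have "g S = (\<Sum>j\<in>{k}. f S ^ (j - k) * A j S)"
        unfolding g_def using less.prems f(2)[OF that]
        by (intro sum.mono_neutral_right) auto
      then show ?thesis using g0[of S] that Z'(1) by auto
    qed
    then show ?case unfolding A_def using alg_indepD[OF fs(1), where c = "\<lambda>ks. c (k # ks)"] by blast
  qed
  then show "\<forall>ks\<in>exp_lists (length (f # fs)) N. c ks = 0"
    by (auto simp: exp_lists_Suc)
qed

text \<open>Each strict inclusion supplies one more function: it vanishes on the smaller set and not
  on the larger. The start is the empty list, whose only monomial is 1 and does not vanish on the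
  nonempty Z 0.\<close>

lemma chain_alg_indep:
  assumes Q: "Q \<subseteq> Bil2"
    and Z: "\<And>i. i \<le> n \<Longrightarrow> closedin (subtopology zariski Q) (Z i) \<and> irreducible_in (subtopology zariski Q) (Z i)"
    and less: "\<And>i. i < n \<Longrightarrow> Z i \<subset> Z (Suc i)"
  shows "m \<le> n \<Longrightarrow> \<exists>fs. length fs = m \<and> (\<forall>f\<in>set fs. polyfun f) \<and> alg_indep fs (Z m)"
proof (induction m)
  case 0
  have "Z 0 \<noteq> {}" using Z[of 0] by (simp add: irreducible_in_def)
  then have "alg_indep [] (Z 0)" by (auto simp: alg_indep_def exp_lists_0)
  then show ?case by (intro exI[of _ "[]"]) simp
next
  case (Suc m)
  then obtain fs where fs: "length fs = m" "\<forall>f\<in>set fs. polyfun f" "alg_indep fs (Z m)" by auto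
  obtain C where C: "closedin zariski C" "Z m = C \<inter> Q"
    using Z[of m] Suc.prems by (auto simp: closedin_subtopology)
  then obtain F where F: "\<And>f. f \<in> F \<Longrightarrow> polyfun f" "Z m = zero_locus F \<inter> Q"
    by (auto simp: closedin_zariski)
  have sub: "Z m \<subset> Z (Suc m)" using less Suc.prems by simp
  then obtain s where s: "s \<in> Z (Suc m)" "s \<notin> Z m" by blast
  have "s \<in> Q" using s Z[of "Suc m"] Suc.prems by (auto simp: irreducible_in_def)
  then obtain f where f: "f \<in> F" "f s \<noteq> 0" using s F(2) Q by (auto simp: zero_locus_def)
  have "alg_indep (f # fs) (Z (Suc m))"
    by (rule alg_indep_Cons[OF fs(3,2) F(1)[OF f(1)] _ _ _ Q s(1) f(2)])
       (use f sub F(2) Z[of "Suc m"] Suc.prems in \<open>auto simp: zero_locus_def\<close>)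
  then show ?case using fs F(1)[OF f(1)] by (intro exI[of _ "f # fs"]) auto
qed

lemma pole_order_power: assumes "pole_order T D f" shows "pole_order T (k * D) (\<lambda>S. f S ^ k)"
proof (induction k)
  case 0
  show ?case using pole_order_const[of T 1] by simp
next
  case (Suc k)
  from pole_order_mult[OF assms Suc] show ?case by simp
qed

lemma pole_order_list_mon:
  assumes "\<And>f. f \<in> set fs \<Longrightarrow> pole_order T D f" "set ks \<subseteq> {..<N}"
  shows "pole_order T (length fs * (N * D)) (list_mon fs ks)"
  using assms
proof (induction fs ks rule: list_induct2')
  case (4 f fs k ks)
  have "pole_order T (N * D) (\<lambda>S. f S ^ k)"
    by (rule pole_order_mono[OF pole_order_power]) (use 4 in auto)
  from pole_order_mult[OF this 4(1)] 4 show ?case by (auto simp: algebra_simps)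
qed (auto simp: list_mon_Nil intro: pole_order_mono[OF pole_order_const])

lemma common_pole_order:
  assumes "\<forall>f\<in>set fs. polyfun f" "T \<in> Bil2"
  shows "\<exists>D. \<forall>f\<in>set fs. pole_order T D f"
  using assms(1)
proof (induction fs)
  case (Cons f fs)
  then obtain D E where "\<forall>g\<in>set fs. pole_order T D g" "pole_order T E f"
    using polyfun_pole_order[OF _ assms(2)] by force
  then show ?case by (intro exI[of _ "max D E"]) (auto intro: pole_order_mono)
qed simp

text \<open>Extension by 0 outside \<open>A\<close> makes monomials that agree on \<open>A\<close>
  equal as functions, so linear algebra in the full function space counts them once.\<close>

lemma entry_poly_restrict:
  assumes h: "h \<in> entry_poly K" and M: "\<And>e. e \<in> exponents K \<Longrightarrow> \<exists>e'\<in>M. \<forall>w\<in>A. entry_mon e w = entry_mon e' w"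
  shows "(\<lambda>w. if w \<in> A then h w else 0) \<in> fs.span ((\<lambda>e w. if w \<in> A then entry_mon e w else 0) ` M)"
    (is "_ \<in> fs.span ?B")
  using h unfolding entry_poly_def
proof (induction rule: fs.span_induct_alt)
  case base
  have "(\<lambda>w. if w \<in> A then 0 w else 0) = 0" by (simp add: fun_eq_iff)
  then show ?case using fs.span_zero[of ?B] by (rule ssubst[where P = "\<lambda>f. f \<in> fs.span ?B"])
next
  case (step c x y)
  then obtain e where e: "e \<in> exponents K" "x = entry_mon e" by auto
  then obtain e' where e': "e' \<in> M" "\<forall>w\<in>A. entry_mon e w = entry_mon e' w" using M by blast
  have "(\<lambda>w. if w \<in> A then x w else 0) = (\<lambda>w. if w \<in> A then entry_mon e' w else 0)"
    using e e' by auto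
  then have "(\<lambda>w. if w \<in> A then x w else 0) \<in> fs.span ?B"
    using e'(1) by (auto intro: fs.span_base)
  from fs.span_add[OF fs.span_scale[OF this, of c] step(2)]
  show ?case by (rule back_subst[where P = "\<lambda>f. f \<in> fs.span ?B"]) (auto simp: fun_eq_iff)
qed

text \<open>A chain of length \<open>n\<close> yields \<open>n\<close> algebraically independent functions. Their \<open>N ^ n\<close> monomials
  with exponents below \<open>N\<close> pull back to polynomials on \<open>A\<close> of degree \<open>O(N)\<close> in each of \<open>d\<close> free
  entries, which leaves room for \<open>O(N ^ d)\<close> independent functions only.\<close>
lemma orbit_dim_le:
  assumes T: "T \<in> Bil2" and A: "\<And>w. w \<in> A \<Longrightarrow> wdet w \<noteq> 0"
    and dense: "\<And>f. polyfun f \<Longrightarrow> (\<And>u v. (u, v) \<in> A \<Longrightarrow> f (act (lin u v) T) = 0) \<Longrightarrow>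
        (\<And>S. S \<in> orbit T \<Longrightarrow> f S = 0)"
    and card: "\<And>K. \<exists>M. finite M \<and> card M \<le> (K + 1) ^ d \<and>
        (\<forall>e\<in>exponents K. \<exists>e'\<in>M. \<forall>w\<in>A. entry_mon e w = entry_mon e' w)"
  shows "orbit_dim T \<le> enat d"
  unfolding orbit_dim_def krull_dim_def
proof (rule Sup_least, safe)
  fix n and Z :: "nat \<Rightarrow> bilpair set"
  assume Z: "\<forall>i\<le>n. closedin (subtopology zariski (orbit T)) (Z i) \<and>
          irreducible_in (subtopology zariski (orbit T)) (Z i)"
    and less: "\<forall>i<n. Z i \<subset> Z (Suc i)"
  note Q = orbit_Bil2[OF T]
  obtain fs where fs: "length fs = n" "\<forall>f\<in>set fs. polyfun f" "alg_indep fs (Z n)"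
    using chain_alg_indep[OF Q, of n Z n] Z less by auto
  obtain D where D: "\<And>f. f \<in> set fs \<Longrightarrow> pole_order T D f" using common_pole_order[OF fs(2) T] by auto
  have ZO: "Z n \<subseteq> orbit T" using Z by (auto simp: irreducible_in_def)
  have bound: "N ^ n \<le> (2 * (n * (N * D)) + 1) ^ d" for N
  proof -
    let ?E = "n * (N * D)"
    have "\<forall>ks\<in>exp_lists n N. \<exists>h. h \<in> entry_poly (2 * ?E) \<and>
       (\<forall>u v. det2 u v \<noteq> 0 \<longrightarrow> list_mon fs ks (act (lin u v) T) * det2 u v ^ ?E = h (u, v))"
    proof
      fix ks assume "ks \<in> exp_lists n N"
      then have "pole_order T ?E (list_mon fs ks)"
        using pole_order_list_mon[of fs T D ks N] D by (simp add: exp_lists_def fs(1))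
      then show "\<exists>h. h \<in> entry_poly (2 * ?E) \<and>
         (\<forall>u v. det2 u v \<noteq> 0 \<longrightarrow> list_mon fs ks (act (lin u v) T) * det2 u v ^ ?E = h (u, v))"
        unfolding pole_order_def by blast
    qed
    then obtain h where h: "\<And>ks. ks \<in> exp_lists n N \<Longrightarrow> h ks \<in> entry_poly (2 * ?E)"
       "\<And>ks u v. ks \<in> exp_lists n N \<Longrightarrow> det2 u v \<noteq> 0 \<Longrightarrow>
          list_mon fs ks (act (lin u v) T) * det2 u v ^ ?E = h ks (u, v)"
      by metis
    obtain M where M: "finite M" "card M \<le> (2 * ?E + 1) ^ d"
        "\<And>e. e \<in> exponents (2 * ?E) \<Longrightarrow> \<exists>e'\<in>M. \<forall>w\<in>A. entry_mon e w = entry_mon e' w"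
      using card[of "2 * ?E"] by blast
    let ?B = "(\<lambda>e w. if w \<in> A then entry_mon e w else 0) ` M"
    have "card (exp_lists n N) \<le> card ?B"
    proof (rule card_le_of_independent[where h = "\<lambda>ks w. if w \<in> A then h ks w else 0"])
      fix c :: "nat list \<Rightarrow> complex"
      assume z: "\<And>x. (\<Sum>i\<in>exp_lists n N. c i * (if x \<in> A then h i x else 0)) = 0"
      let ?f = "\<lambda>S. \<Sum>ks\<in>exp_lists n N. c ks * list_mon fs ks S"
      have entry_poly: "polyfun ?f" by (intro polyfun_sum polyfun_cmult polyfun_list_mon fs)
      have fA: "?f (act (lin u v) T) = 0" if "(u, v) \<in> A" for u v
      proof -
        have d: "det2 u v \<noteq> 0" using A[OF that] by simp
        have "?f (act (lin u v) T) * det2 u v ^ ?E = (\<Sum>i\<in>exp_lists n N. c i * h i (u, v))"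
          unfolding sum_distrib_right by (intro sum.cong) (auto simp: h(2)[OF _ d] mult.assoc)
        then show ?thesis using z[of "(u, v)"] that d by simp
      qed
      \<comment> \<open>A linear relation between the pullbacks on \<open>A\<close> spreads over the
        whole orbit and contradicts independence on Z n unless it is trivial.\<close>
      from dense[OF entry_poly fA] ZO have "\<And>S. S \<in> Z n \<Longrightarrow> ?f S = 0" by blast
      then show "\<forall>i\<in>exp_lists n N. c i = 0" using alg_indepD[OF fs(3)] fs(1) by blast
    qed (auto intro!: finite_exp_lists entry_poly_restrict[OF h(1) M(3)] M(1))
    also have "\<dots> \<le> card M" by (rule card_image_le[OF M(1)])
    finally show ?thesis using M(2) by (simp add: card_exp_lists)
  qed
  show "enat n \<le> enat d"
  proof (rule ccontr)
    assume "\<not> enat n \<le> enat d"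
    then have nd: "Suc d \<le> n" by simp
    \<comment> \<open>The base in \<open>bound\<close> is at most C N, so n > d would give N^(d+1)
      \<le> C^d N^d, which fails as soon as N > C^d.\<close>
    define C where "C = 2 * (n * D) + 1"
    define N where "N = C ^ d + 1"
    have "N ^ Suc d \<le> N ^ n" by (rule power_increasing[OF nd]) (simp add: N_def)
    also have "\<dots> \<le> (2 * (n * (N * D)) + 1) ^ d" by (rule bound)
    also have "\<dots> \<le> (C * N) ^ d" by (rule power_mono) (auto simp: C_def N_def algebra_simps)
    also have "\<dots> = C ^ d * N ^ d" by (rule power_mult_distrib)
    also have "\<dots> < N * N ^ d" by (simp add: N_def)
    finally show False by simp
  qed
qed

section \<open>Lower bound for the dimension\<close>

text \<open>The image of an irreducible set of matrices is irreducible, because the equations of two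
  closed sets covering it pull back to polynomials in the entries. Its relative closure inherits
  irreducibility.\<close>

lemma irreducible_affine_part:
  assumes T: "T \<in> Bil2" and A: "affine_part A" "A \<noteq> {}"
  defines "E \<equiv> {act (lin u v) T | u v. (u, v) \<in> A}"
  shows "irreducible_in (subtopology zariski (orbit T)) (orbit T \<inter> zariski closure_of E)"
proof -
  note Q = orbit_Bil2[OF T]
  let ?X = "subtopology zariski (orbit T)" and ?Z = "orbit T \<inter> zariski closure_of E"
  have dA: "det2 u v \<noteq> 0" if "(u, v) \<in> A" for u v using that A by (force simp: affine_part_def)
  have EO: "E \<subseteq> orbit T" using dA unfolding E_def subset_iff orbit_iff_lin by blast
  have EZ: "E \<subseteq> ?Z" using EO Q closure_of_subset[of E zariski] by (auto simp: topspace_zariski)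
  have top: "topspace ?X = orbit T" using Q by (auto simp: topspace_zariski)
  have closed: "?Z \<subseteq> B" if B: "closedin ?X B" "E \<subseteq> B" for B
  proof -
    obtain C where "closedin zariski C" "B = C \<inter> orbit T" using B(1) by (auto simp: closedin_subtopology)
    then show ?thesis using B(2) closure_of_minimal[of E C zariski] by auto
  qed
  have "E \<subseteq> B \<or> E \<subseteq> C" if BC: "closedin ?X B" "closedin ?X C" "E \<subseteq> B \<union> C" for B C
  proof (rule ccontr)
    assume "\<not> ?thesis"
    then obtain x y where xy: "x \<in> E" "x \<notin> B" "y \<in> E" "y \<notin> C" by auto
    obtain F G where F: "\<And>f. f \<in> F \<Longrightarrow> polyfun f" "B = zero_locus F \<inter> orbit T"
      and G: "\<And>f. f \<in> G \<Longrightarrow> polyfun f" "C = zero_locus G \<inter> orbit T"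
      using BC(1,2) by (auto simp: closedin_subtopology closedin_zariski)
    obtain f g where f: "f \<in> F" "f x \<noteq> 0" and g: "g \<in> G" "g y \<noteq> 0"
      using not_in_zero_locus[OF subsetD[OF EO xy(1)] Q] not_in_zero_locus[OF subsetD[OF EO xy(3)] Q]
        xy(2,4) F(2) G(2) by metis
    obtain K h where h: "h \<in> entry_poly K" "\<And>u v. det2 u v \<noteq> 0 \<Longrightarrow> f (act (lin u v) T) = 0 \<longleftrightarrow> h (u, v) = 0"
      using polyfun_pullback[OF F(1)[OF f(1)] T] by metis
    obtain L k where k: "k \<in> entry_poly L" "\<And>u v. det2 u v \<noteq> 0 \<Longrightarrow> g (act (lin u v) T) = 0 \<longleftrightarrow> k (u, v) = 0"
      using polyfun_pullback[OF G(1)[OF g(1)] T] by metis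
    have "h w = 0 \<or> k w = 0" if "w \<in> A" for w
    proof -
      obtain u v where w: "w = (u, v)" by force
      have "act (lin u v) T \<in> B \<union> C" using that BC(3) by (auto simp: w E_def)
      then have "f (act (lin u v) T) = 0 \<or> g (act (lin u v) T) = 0"
        using F G f g by (auto simp: zero_locus_def)
      then show ?thesis using that dA by (simp add: w h k)
    qed
    from affine_part_irreducible[OF A(1) h(1) k(1) this]
    consider "\<And>w. w \<in> A \<Longrightarrow> h w = 0" | "\<And>w. w \<in> A \<Longrightarrow> k w = 0" by blast
    then show False
    proof cases
      case 1
      obtain u v where "x = act (lin u v) T" "(u, v) \<in> A" using xy(1) by (auto simp: E_def)
      with 1 h(2) dA f(2) show False by blast
    next
      case 2
      obtain u v where "y = act (lin u v) T" "(u, v) \<in> A" using xy(3) by (auto simp: E_def)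
      with 2 k(2) dA g(2) show False by blast
    qed
  qed
  then have "?Z \<subseteq> B \<or> ?Z \<subseteq> C" if "closedin ?X B" "closedin ?X C" "?Z \<subseteq> B \<union> C" for B C
    using that EZ closed by (meson subset_trans)
  moreover have "?Z \<noteq> {}" using A(2) EZ by (auto simp: E_def)
  ultimately show ?thesis unfolding irreducible_in_def top by blast
qed

lemma orbit_dim_ge:
  assumes T: "T \<in> Bil2" and A: "\<And>i. i \<le> n \<Longrightarrow> affine_part (A i) \<and> A i \<noteq> {}"
    and sub: "\<And>i. i < n \<Longrightarrow> A i \<subseteq> A (Suc i)"
    and sep: "\<And>i. i < n \<Longrightarrow> \<exists>f. regular f \<and> (\<forall>(u, v)\<in>A i. f (act (lin u v) T) = 0) \<and>
       (\<exists>(u, v)\<in>A (Suc i). f (act (lin u v) T) \<noteq> 0)"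
  shows "enat n \<le> orbit_dim T"
proof -
  note Q = orbit_Bil2[OF T]
  define E where "E = (\<lambda>i. {act (lin u v) T | u v. (u, v) \<in> A i})"
  let ?X = "subtopology zariski (orbit T)"
  let ?Z = "\<lambda>i. orbit T \<inter> zariski closure_of E i"
  have EO: "E i \<subseteq> orbit T" if "i \<le> n" for i
  proof
    fix S assume "S \<in> E i"
    then obtain u v where S: "S = act (lin u v) T" "(u, v) \<in> A i" by (auto simp: E_def)
    then have "wdet (u, v) \<noteq> 0" using A[OF that] unfolding affine_part_def by blast
    then show "S \<in> orbit T" using S(1) orbit_iff_lin by auto
  qed
  have closed: "closedin ?X (?Z i)" for i
    by (auto simp: closedin_subtopology Int_commute intro!: exI[of _ "zariski closure_of E i"])
  have irr: "irreducible_in ?X (?Z i)" if "i \<le> n" for i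
    unfolding E_def using irreducible_affine_part[OF T] A[OF that] by auto
  have "?Z i \<subset> ?Z (Suc i)" if i: "i < n" for i
  proof -
    have "E i \<subseteq> E (Suc i)" using sub[OF i] by (auto simp: E_def)
    then have "?Z i \<subseteq> ?Z (Suc i)" using closure_of_mono by blast
    moreover obtain f u v where f: "regular f" "\<forall>(u, v)\<in>A i. f (act (lin u v) T) = 0"
      "(u, v) \<in> A (Suc i)" "f (act (lin u v) T) \<noteq> 0"
      using sep[OF i] by blast
    have "act (lin u v) T \<in> E (Suc i)" using f(3) by (auto simp: E_def)
    then have "act (lin u v) T \<in> ?Z (Suc i)"
      using EO[of "Suc i"] i Q closure_of_subset[of "E (Suc i)" zariski] by (auto simp: topspace_zariski)
    moreover have "act (lin u v) T \<notin> ?Z i"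
    proof
      assume "act (lin u v) T \<in> ?Z i"
      then have "act (lin u v) T \<in> zariski closure_of E i" by simp
      moreover have "E i \<subseteq> Bil2" using EO[of i] Q i by simp
      moreover have "f S = 0" if "S \<in> E i" for S using that f(2) by (auto simp: E_def)
      ultimately have "f (act (lin u v) T) = 0" using closure_regular f(1) by blast
      with f(4) show False by simp
    qed
    ultimately show ?thesis by blast
  qed
  then have "\<exists>Z. (\<forall>i\<le>n. closedin ?X (Z i) \<and> irreducible_in ?X (Z i)) \<and> (\<forall>i<n. Z i \<subset> Z (Suc i))"
    using closed irr by (intro exI[of _ ?Z]) simp
  then show ?thesis unfolding orbit_dim_def krull_dim_def
    by (intro Sup_upper CollectI exI[of _ n] conjI refl)
qed

section \<open>Dimensions of the orbits\<close>

lemma orbit_dim_cong: "isomorphic T T' \<Longrightarrow> orbit_dim T = orbit_dim T'"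
  by (simp add: orbit_dim_def orbit_cong)

lemma affine_part_GL: "affine_part {w. wdet w \<noteq> 0}"
  by (simp add: affine_part_def)

lemma GL_nonempty: "\<exists>u v. det2 u v \<noteq> 0"
  by (intro exI[of _ e1] exI[of _ e2]) (simp add: det2_def e_nth)

lemma orbit_dim_le_4: assumes "T \<in> Bil2" shows "orbit_dim T \<le> enat 4"
proof (rule orbit_dim_le[OF assms, of "{w. wdet w \<noteq> 0}"])
  fix f S assume f: "\<And>u v. (u, v) \<in> {w. wdet w \<noteq> 0} \<Longrightarrow> f (act (lin u v) T) = (0::complex)" and "S \<in> orbit T"
  then obtain u v where "det2 u v \<noteq> 0" "S = act (lin u v) T" using orbit_iff_lin by metis
  with f[of u v] show "f S = 0" by simp
next
  fix K :: nat
  have "card (exponents K) = (K + 1) ^ 4" by (simp add: exponents_def card_cartesian_product power4_eq_xxxx)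
  moreover have "finite (exponents K)" by (simp add: exponents_def)
  ultimately show "\<exists>M. finite M \<and> card M \<le> (K + 1) ^ 4 \<and>
      (\<forall>e\<in>exponents K. \<exists>e'\<in>M. \<forall>w\<in>{w. wdet w \<noteq> 0}. entry_mon e w = entry_mon e' w)"
    by (intro exI[of _ "exponents K"]) auto
qed simp

text \<open>The new columns are those of the matrix product (u v)(p q), so the stabiliser acts from
  the right.\<close>

lemma act_stabilizer:
  assumes d: "det2 u v \<noteq> 0" "det2 p q \<noteq> 0" and s: "act (lin p q) T = T"
  shows "act (lin (lin u v p) (lin u v q)) T = act (lin u v) T" "det2 (lin u v p) (lin u v q) \<noteq> 0"
proof -
  have l: "lin (lin u v p) (lin u v q) x = lin u v (lin p q x)" for x
    by (simp add: V_eq_iff lin_nth algebra_simps)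
  have "det2 (lin u v p) (lin u v q) = det2 u v * det2 p q"
    by (simp add: det2_def lin_nth algebra_simps)
  with d show d': "det2 (lin u v p) (lin u v q) \<noteq> 0" by simp
  have "lin p q (fst T x y) = fst T (lin p q x) (lin p q y)"
      "lin p q (snd T x y) = snd T (lin p q x) (lin p q y)" for x y
    using s by (simp_all add: act_lin_eq_iff[OF d(2)])
  then show "act (lin (lin u v p) (lin u v q)) T = act (lin u v) T"
    unfolding act_lin_eq_iff[OF d'] l using d(1) by (simp add: act_lin)
qed

lemma act_bil_fixed:
  assumes "det2 p q \<noteq> 0" "T = (bil a b c d, bil a' b' c' d')"
    "lin p q a = fst T p p" "lin p q b = fst T p q" "lin p q c = fst T q p" "lin p q d = fst T q q"
    "lin p q a' = snd T p p" "lin p q b' = snd T p q" "lin p q c' = snd T q p" "lin p q d' = snd T q q"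
  shows "act (lin p q) T = T"
  using assms unfolding act_lin_eq_iff[OF assms(1)] by (auto intro!: hom_bil cbilinear_bil)

text \<open>Off the hypersurface c = 0 the stabiliser moves a matrix into \<open>A\<close>, so the
  pullback of f vanishes there. Irreducibility of the general linear group makes it vanish
  everywhere.\<close>

lemma orbit_dense:
  assumes T: "T \<in> Bil2" and c: "c \<in> entry_poly K" "wdet w \<noteq> 0" "c w \<noteq> 0"
    and stab: "\<And>u v. det2 u v \<noteq> 0 \<Longrightarrow> c (u, v) \<noteq> 0 \<Longrightarrow>
        \<exists>p q. det2 p q \<noteq> 0 \<and> act (lin p q) T = T \<and> (lin u v p, lin u v q) \<in> A"
    and f: "polyfun f" "\<And>u v. (u, v) \<in> A \<Longrightarrow> f (act (lin u v) T) = 0" and S: "S \<in> orbit T"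
  shows "f S = 0"
proof -
  obtain L h where h: "h \<in> entry_poly L" "\<And>u v. det2 u v \<noteq> 0 \<Longrightarrow> f (act (lin u v) T) = 0 \<longleftrightarrow> h (u, v) = 0"
    using polyfun_pullback[OF f(1) T] by metis
  have "h w = 0 \<or> c w = 0" if "w \<in> {w. wdet w \<noteq> 0}" for w
  proof (rule disjCI)
    obtain u v where w: "w = (u, v)" by force
    have d: "det2 u v \<noteq> 0" using that by (simp add: w)
    assume "c w \<noteq> 0"
    from stab[OF d this[unfolded w]] obtain p q where pq: "det2 p q \<noteq> 0" "act (lin p q) T = T"
        "(lin u v p, lin u v q) \<in> A" by blast
    from f(2)[OF pq(3)] have "f (act (lin u v) T) = 0" by (simp add: act_stabilizer[OF d pq(1,2)])
    then show "h w = 0" using h(2)[OF d] by (simp add: w)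
  qed
  from affine_part_irreducible[OF affine_part_GL h(1) c(1) this] c(2,3)
  have "h w' = 0" if "wdet w' \<noteq> 0" for w' using that by blast
  moreover obtain u v where "det2 u v \<noteq> 0" "S = act (lin u v) T" using S orbit_iff_lin by metis
  ultimately show ?thesis using h(2) by simp
qed

lemma orbit_dim_le_chart:
  assumes T: "T \<in> Bil2" and c: "c \<in> entry_poly K" "wdet w \<noteq> 0" "c w \<noteq> 0"
    and stab: "\<And>u v. det2 u v \<noteq> 0 \<Longrightarrow> c (u, v) \<noteq> 0 \<Longrightarrow>
        \<exists>p q. det2 p q \<noteq> 0 \<and> act (lin p q) T = T \<and> P (lin u v p, lin u v q)"
    and M: "\<And>K. finite (M K)" "\<And>K. card (M K) \<le> (K + 1) ^ d"
    and red: "\<And>K i j k l. (i, j, k, l) \<in> exponents K \<Longrightarrow> \<exists>e\<in>M K. \<forall>w. P w \<longrightarrow> entry_mon (i, j, k, l) w = entry_mon e w"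
  shows "orbit_dim T \<le> enat d"
proof (rule orbit_dim_le[OF T, of "{w. wdet w \<noteq> 0 \<and> P w}"])
  fix f S assume f: "polyfun f" and S: "S \<in> orbit T"
    and z: "\<And>u v. (u, v) \<in> {w. wdet w \<noteq> 0 \<and> P w} \<Longrightarrow> f (act (lin u v) T) = (0::complex)"
  show "f S = 0"
  proof (rule orbit_dense[OF T c _ f z S])
    fix u v assume d: "det2 u v \<noteq> 0" and "c (u, v) \<noteq> 0"
    from stab[OF this] obtain p q where "det2 p q \<noteq> 0" "act (lin p q) T = T" "P (lin u v p, lin u v q)"
      by blast
    then show "\<exists>p q. det2 p q \<noteq> 0 \<and> act (lin p q) T = T \<and>
        (lin u v p, lin u v q) \<in> {w. wdet w \<noteq> 0 \<and> P w}"
      using act_stabilizer(2)[OF d] by (intro exI[of _ p] exI[of _ q]) simp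
  qed
next
  fix K :: nat
  have "\<exists>e'\<in>M K. \<forall>w\<in>{w. wdet w \<noteq> 0 \<and> P w}. entry_mon e w = entry_mon e' w" if "e \<in> exponents K" for e
  proof -
    obtain i j k l where e: "e = (i, j, k, l)" by (metis prod_cases4)
    from red[OF that[unfolded e]] show ?thesis unfolding e by blast
  qed
  with M show "\<exists>M. finite M \<and> card M \<le> (K + 1) ^ d \<and>
      (\<forall>e\<in>exponents K. \<exists>e'\<in>M. \<forall>w\<in>{w. wdet w \<noteq> 0 \<and> P w}. entry_mon e w = entry_mon e' w)"
    by blast
qed simp

text \<open>An entry equal to 1 lets its exponent be replaced by 0, so three free exponents
  remain.\<close>

lemma orbit_dim_le_chart_u:
  assumes "T \<in> Bil2" "c \<in> entry_poly K" "wdet w \<noteq> 0" "c w \<noteq> 0"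
    and "\<And>u v. det2 u v \<noteq> 0 \<Longrightarrow> c (u, v) \<noteq> 0 \<Longrightarrow>
        \<exists>p q. det2 p q \<noteq> 0 \<and> act (lin p q) T = T \<and> lin u v p $ 1 = 1"
  shows "orbit_dim T \<le> enat 3"
proof (rule orbit_dim_le_chart[OF assms(1-4), where P = "\<lambda>w. fst w $ 1 = 1"
      and M = "\<lambda>K. {0} \<times> {..K} \<times> {..K} \<times> {..K}"])
  fix K i j k l assume "(i, j, k, l) \<in> exponents K"
  then show "\<exists>e\<in>{0} \<times> {..K} \<times> {..K} \<times> {..K}. \<forall>w. fst w $ 1 = 1 \<longrightarrow> entry_mon (i, j, k, l) w = entry_mon e w"
    by (intro bexI[of _ "(0, j, k, l)"]) (auto simp: exponents_def)
qed (use assms(5) in \<open>simp_all add: card_cartesian_product power3_eq_cube\<close>)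

lemma orbit_dim_le_chart_v:
  assumes "T \<in> Bil2" "c \<in> entry_poly K" "wdet w \<noteq> 0" "c w \<noteq> 0"
    and "\<And>u v. det2 u v \<noteq> 0 \<Longrightarrow> c (u, v) \<noteq> 0 \<Longrightarrow>
        \<exists>p q. det2 p q \<noteq> 0 \<and> act (lin p q) T = T \<and> lin u v q $ 1 = 1"
  shows "orbit_dim T \<le> enat 3"
proof (rule orbit_dim_le_chart[OF assms(1-4), where P = "\<lambda>w. snd w $ 1 = 1"
      and M = "\<lambda>K. {..K} \<times> {..K} \<times> {0} \<times> {..K}"])
  fix K i j k l assume "(i, j, k, l) \<in> exponents K"
  then show "\<exists>e\<in>{..K} \<times> {..K} \<times> {0} \<times> {..K}. \<forall>w. snd w $ 1 = 1 \<longrightarrow> entry_mon (i, j, k, l) w = entry_mon e w"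
    by (intro bexI[of _ "(i, j, 0, l)"]) (auto simp: exponents_def)
qed (use assms(5) in \<open>simp_all add: card_cartesian_product power3_eq_cube\<close>)

lemma orbit_dim_le_chart_uv:
  assumes "T \<in> Bil2" "c \<in> entry_poly K" "wdet w \<noteq> 0" "c w \<noteq> 0"
    and "\<And>u v. det2 u v \<noteq> 0 \<Longrightarrow> c (u, v) \<noteq> 0 \<Longrightarrow>
        \<exists>p q. det2 p q \<noteq> 0 \<and> act (lin p q) T = T \<and> lin u v p $ 1 = 1 \<and> lin u v q $ 1 = 1"
  shows "orbit_dim T \<le> enat 2"
proof (rule orbit_dim_le_chart[OF assms(1-4), where P = "\<lambda>w. fst w $ 1 = 1 \<and> snd w $ 1 = 1"
      and M = "\<lambda>K. {0} \<times> {..K} \<times> {0} \<times> {..K}"])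
  fix K i j k l assume "(i, j, k, l) \<in> exponents K"
  then show "\<exists>e\<in>{0} \<times> {..K} \<times> {0} \<times> {..K}.
      \<forall>w. fst w $ 1 = 1 \<and> snd w $ 1 = 1 \<longrightarrow> entry_mon (i, j, k, l) w = entry_mon e w"
    by (intro bexI[of _ "(0, j, 0, l)"]) (auto simp: exponents_def)
qed (use assms(5) in \<open>simp_all add: card_cartesian_product power2_eq_square\<close>)

lemmas chart_eval = V_eq_iff lin_nth bil_nth e_nth det2_def

lemma entry_witness: "wdet (e2, e1) \<noteq> 0" "snd (e2, e1) $ 1 \<noteq> (0::complex)"
   "wdet (e1, e2) \<noteq> 0" "fst (e1, e2) $ 1 \<noteq> (0::complex)"
  by (simp_all add: det2_def e_nth)

section \<open>Stabilisers and the upper bounds they give\<close>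

lemma stabilizer_scale_e2:
  assumes "T \<in> {C05 \<alpha>, C06 \<alpha>, C10 \<alpha>, C12 \<alpha>}" "s \<noteq> 0"
  shows "act (lin e1 (s *s e2)) (str T) = str T"
  using assms by (auto intro!: act_bil_fixed simp: chart_eval)

lemma stabilizer_scale_e1: "s \<noteq> 0 \<Longrightarrow> act (lin (s *s e1) e2) (str C04) = str C04"
  by (auto intro!: act_bil_fixed simp: chart_eval)

lemma stabilizer_shear:
  assumes "T \<in> {C01, C02}" shows "act (lin (e1 + b *s e2) e2) (str T) = str T"
  using assms by (auto intro!: act_bil_fixed simp: chart_eval)

lemma stabilizer_triangular:
  assumes "T \<in> {C05 1, C06 0}" "s \<noteq> 0" shows "act (lin (e1 + b *s e2) (s *s e2)) (str T) = str T"
  using assms by (auto intro!: act_bil_fixed simp: chart_eval algebra_simps)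

lemma stabilizer_nilpotent:
  assumes "T \<in> {C03, C17 \<beta>}" "s \<noteq> 0" shows "act (lin (s *s e1 + b *s e2) ((s * s) *s e2)) (str T) = str T"
proof -
  let ?g = "lin (s *s e1 + b *s e2) ((s * s) *s e2)"
  have "act ?g (str C03) = str C03" unfolding str.simps
    by (rule act_bil_fixed[OF _ refl]) (simp_all add: chart_eval assms(2))
  moreover have "act ?g (str (C17 \<beta>)) = str (C17 \<beta>)" unfolding str.simps
    by (rule act_bil_fixed[OF _ refl]) (simp_all add: chart_eval assms(2))
  ultimately show ?thesis using assms(1) by blast
qed

lemma orbit_dim_le_3:
  assumes "T \<in> {C01, C02, C04, C05 \<alpha>, C06 \<alpha>, C10 \<alpha>, C12 \<alpha>}"
  shows "orbit_dim (str T) \<le> enat 3"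
proof -
  consider "T \<in> {C01, C02}" | "T = C04" | "T \<in> {C05 \<alpha>, C06 \<alpha>, C10 \<alpha>, C12 \<alpha>}" using assms by auto
  then show ?thesis
  proof cases
    case 1
    show ?thesis
    proof (rule orbit_dim_le_chart_u[OF str_Bil2 entry_poly_entry(2) entry_witness(1,2)])
      fix u v :: V assume "snd (u, v) $ 1 \<noteq> 0"
      \<comment> \<open>The shear by b turns the first entry of the first column into u_1 + b v_1;
        this b makes it 1.\<close>
      with stabilizer_shear[OF 1, of "(1 - u $ 1) / v $ 1"]
      show "\<exists>p q. det2 p q \<noteq> 0 \<and> act (lin p q) (str T) = str T \<and> lin u v p $ 1 = 1"
        by (intro exI[of _ "e1 + ((1 - u $ 1) / v $ 1) *s e2"] exI[of _ e2]) (simp add: chart_eval)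
    qed
  next
    case 2
    show ?thesis
    proof (rule orbit_dim_le_chart_u[OF str_Bil2 entry_poly_entry(1) entry_witness(3,4)])
      fix u v :: V assume "fst (u, v) $ 1 \<noteq> 0"
      with stabilizer_scale_e1[of "1 / u $ 1"]
      show "\<exists>p q. det2 p q \<noteq> 0 \<and> act (lin p q) (str T) = str T \<and> lin u v p $ 1 = 1"
        by (intro exI[of _ "(1 / u $ 1) *s e1"] exI[of _ e2]) (simp add: chart_eval 2)
    qed
  next
    case 3
    show ?thesis
    proof (rule orbit_dim_le_chart_v[OF str_Bil2 entry_poly_entry(2) entry_witness(1,2)])
      fix u v :: V assume "snd (u, v) $ 1 \<noteq> 0"
      with stabilizer_scale_e2[OF 3, of "1 / v $ 1"]
      show "\<exists>p q. det2 p q \<noteq> 0 \<and> act (lin p q) (str T) = str T \<and> lin u v q $ 1 = 1"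
        by (intro exI[of _ e1] exI[of _ "(1 / v $ 1) *s e2"]) (simp add: chart_eval)
    qed
  qed
qed

lemma orbit_dim_le_2:
  assumes "T \<in> {C03, C05 1, C06 0, C17 \<beta>}"
  shows "orbit_dim (str T) \<le> enat 2"
proof (rule orbit_dim_le_chart_uv[OF str_Bil2 entry_poly_entry(2) entry_witness(1,2)])
  fix u v :: V assume v: "snd (u, v) $ 1 \<noteq> 0"
  \<comment> \<open>In the nilpotent case the stabiliser scales \<open>e2\<close> by s^2, so
    normalising the second column means s^2 v_1 = 1. The shear parameter then solves s u_1 + b v_1 =
    1.\<close>
  define s where "s = csqrt (1 / v $ 1)"
  have s: "s * s = 1 / v $ 1" using power2_csqrt[of "1 / v $ 1"] by (simp add: s_def power2_eq_square)
  with v have s0: "s \<noteq> 0" by auto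
  consider "T \<in> {C05 1, C06 0}" | "T \<in> {C03, C17 \<beta>}" using assms by auto
  then show "\<exists>p q. det2 p q \<noteq> 0 \<and> act (lin p q) (str T) = str T \<and> lin u v p $ 1 = 1 \<and> lin u v q $ 1 = 1"
  proof cases
    case 1
    with v stabilizer_triangular[OF 1, of "1 / v $ 1" "(1 - u $ 1) / v $ 1"] show ?thesis
      by (intro exI[of _ "e1 + ((1 - u $ 1) / v $ 1) *s e2"] exI[of _ "(1 / v $ 1) *s e2"])
         (simp add: chart_eval)
  next
    case 2
    with v s s0 stabilizer_nilpotent[OF 2 s0, of "(1 - s * u $ 1) / v $ 1"] show ?thesis
      by (intro exI[of _ "s *s e1 + ((1 - s * u $ 1) / v $ 1) *s e2"] exI[of _ "(s * s) *s e2"])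
         (simp add: chart_eval)
  qed
qed

section \<open>The flag of matrix groups and the lower bounds\<close>

text \<open>The stabiliser of the line of \<open>e2\<close>. Inside it,
  \<open>mirabolic_part\<close> fixes \<open>e1\<close> modulo that line and
  \<open>torus_part\<close> fixes \<open>e1\<close> itself; the three depend on 3, 2 and 1 free
  entries.\<close>

definition borel_part :: "(V \<times> V) set" where "borel_part = {w. wdet w \<noteq> 0 \<and> snd w $ 1 = 0}"
definition mirabolic_part :: "(V \<times> V) set" where "mirabolic_part = {w. wdet w \<noteq> 0 \<and> fst w $ 1 = 1 \<and> snd w $ 1 = 0}"
definition torus_part :: "(V \<times> V) set" where "torus_part = {w. wdet w \<noteq> 0 \<and> fst w = e1 \<and> snd w $ 1 = 0}"

lemma affine_parts:
  "affine_part borel_part" "affine_part mirabolic_part" "affine_part torus_part" "affine_part {(e1, e2)}"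
  by (auto simp: affine_part_def borel_part_def mirabolic_part_def torus_part_def line_def V_eq_iff det2_def e_nth algebra_simps)

lemma flag_mem:
  "(e1, e2) \<in> torus_part" "(e1 + 3 *s e2, e2) \<in> mirabolic_part" "(e1, 2 *s e2) \<in> torus_part" "(2 *s e1, e2) \<in> borel_part"
  "torus_part \<subseteq> mirabolic_part" "mirabolic_part \<subseteq> borel_part" "borel_part \<subseteq> {w. wdet w \<noteq> 0}"
  by (auto simp: borel_part_def mirabolic_part_def torus_part_def V_eq_iff det2_def e_nth)

lemma act_id: "act (lin e1 e2) T = T"
  by (simp add: act_lin_eq_iff det2_def e_nth)

text \<open>The short flag identity, Borel group, full group. It takes arbitrary separating
  functions and so also covers algebras without a nonzero trace form.\<close>

lemma orbit_dim_ge_flag2: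
  assumes T: "T \<in> Bil2"
    and f: "regular f" "\<And>u v. (u, v) \<in> borel_part \<Longrightarrow> f (act (lin u v) T) = 0"
       "det2 u v \<noteq> 0" "f (act (lin u v) T) \<noteq> 0"
    and g: "regular g" "(u', v') \<in> borel_part" "g (act (lin u' v') T) \<noteq> g T"
  shows "enat 2 \<le> orbit_dim T"
proof -
  let ?A = "\<lambda>i::nat. if i = 0 then {(e1, e2)} else if i = 1 then borel_part else {w. wdet w \<noteq> 0}"
  show ?thesis
  proof (rule orbit_dim_ge[OF T, of 2 ?A])
    fix i :: nat assume "i < 2"
    then consider "i = 0" | "i = 1" by linarith
    then show "\<exists>f. regular f \<and> (\<forall>(u, v)\<in>?A i. f (act (lin u v) T) = 0) \<and>
       (\<exists>(u, v)\<in>?A (Suc i). f (act (lin u v) T) \<noteq> 0)"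
    proof cases
      case 1
      then show ?thesis using g
        by (intro exI[of _ "\<lambda>S. g S - g T"]) (auto intro: regular_intros simp: act_id)
    next
      case 2
      then show ?thesis using f by (intro exI[of _ f]) auto
    qed
  qed (use affine_parts affine_part_GL GL_nonempty flag_mem in auto)
qed

text \<open>A linear form attached covariantly to the algebra and normalised to vanish on \<open>e2\<close>: its values
  at \<open>e2\<close> and \<open>e1\<close> separate the closures belonging to the flag of matrix groups.\<close>
locale covariant_form =
  fixes \<tau> :: "bilpair \<Rightarrow> V \<Rightarrow> complex" and T :: bilpair
  assumes T: "T \<in> Bil2"
    and act: "\<And>u v x. det2 u v \<noteq> 0 \<Longrightarrow> \<tau> (act (lin u v) T) (lin u v x) = \<tau> T x"
    and regular_form: "\<And>x. regular (\<lambda>S. \<tau> S x)"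
    and lin_form: "\<And>x. \<tau> T x = x $ 1 * \<tau> T e1"
    and nonzero: "\<tau> T e1 \<noteq> 0"
begin

text \<open>A Borel matrix preserves the line of \<open>e2\<close>, which is the kernel of the form
  at \<open>T\<close>.\<close>

lemma form_borel: "(u, v) \<in> borel_part \<Longrightarrow> \<tau> (act (lin u v) T) e2 = 0"
proof -
  assume uv: "(u, v) \<in> borel_part"
  have d: "det2 u v \<noteq> 0" using uv by (simp add: borel_part_def)
  have "e2 = lin u v ((1 / v $ 2) *s e2)"
    using uv by (auto simp: borel_part_def chart_eval)
  then have "\<tau> (act (lin u v) T) e2 = \<tau> T ((1 / v $ 2) *s e2)" using act[OF d] by metis
  also have "\<dots> = 0" by (subst lin_form) (simp add: e_nth)
  finally show ?thesis .
qed

lemma form_mirabolic: "(u, v) \<in> mirabolic_part \<Longrightarrow> \<tau> (act (lin u v) T) e1 = \<tau> T e1"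
proof -
  assume uv: "(u, v) \<in> mirabolic_part"
  have d: "det2 u v \<noteq> 0" using uv by (simp add: mirabolic_part_def)
  have "e1 = lin u v (e1 - (u $ 2 / v $ 2) *s e2)"
    using uv by (auto simp: mirabolic_part_def chart_eval)
  then have "\<tau> (act (lin u v) T) e1 = \<tau> T (e1 - (u $ 2 / v $ 2) *s e2)" using act[OF d] by metis
  also have "\<dots> = \<tau> T e1" by (subst lin_form) (simp add: e_nth)
  finally show ?thesis .
qed

lemma form_swap: "\<tau> (act (lin e2 e1) T) e2 \<noteq> 0"
  using act[of e2 e1 e1] nonzero by (simp add: det2_def e_nth)

lemma form_scale: "\<tau> (act (lin (2 *s e1) e2) T) e1 \<noteq> \<tau> T e1"
proof -
  have eq: "lin (2 *s e1) e2 ((1/2) *s e1) = e1" by (simp add: chart_eval)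
  have "det2 (2 *s e1) e2 \<noteq> 0" by (simp add: chart_eval)
  from act[OF this, of "(1/2) *s e1"]
  have "\<tau> (act (lin (2 *s e1) e2) T) e1 = \<tau> T ((1/2) *s e1)" unfolding eq .
  also have "\<dots> = \<tau> T e1 / 2" by (subst lin_form) (simp add: e_nth)
  finally show ?thesis using nonzero by auto
qed

lemma separate_top:
  "\<exists>f. regular f \<and> (\<forall>(u, v)\<in>borel_part. f (act (lin u v) T) = 0) \<and>
     (\<exists>(u, v)\<in>{w. wdet w \<noteq> 0}. f (act (lin u v) T) \<noteq> 0)"
  using form_borel form_swap entry_witness(1)
  by (intro exI[of _ "\<lambda>S. \<tau> S e2"]) (auto intro: regular_form)

lemma separate_borel:
  "\<exists>f. regular f \<and> (\<forall>(u, v)\<in>mirabolic_part. f (act (lin u v) T) = 0) \<and>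
     (\<exists>(u, v)\<in>borel_part. f (act (lin u v) T) \<noteq> 0)"
  using form_mirabolic form_scale flag_mem(4)
  by (intro exI[of _ "\<lambda>S. \<tau> S e1 - \<tau> T e1"]) (auto intro: regular_intros regular_form)

lemma orbit_dim_ge_2: "enat 2 \<le> orbit_dim T"
proof -
  have "det2 e2 e1 \<noteq> 0" using entry_witness(1) by simp
  then show ?thesis
    using orbit_dim_ge_flag2[OF T regular_form[of e2] form_borel _ form_swap regular_form[of e1] flag_mem(4) form_scale]
    by blast
qed

lemma orbit_dim_ge_3:
  assumes g: "regular g" "(u, v) \<in> mirabolic_part" "g (act (lin u v) T) \<noteq> g T"
  shows "enat 3 \<le> orbit_dim T"
proof -
  let ?A = "\<lambda>i::nat. if i = 0 then {(e1, e2)} else if i = 1 then mirabolic_part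
     else if i = 2 then borel_part else {w. wdet w \<noteq> 0}"
  show ?thesis
  proof (rule orbit_dim_ge[OF T, of 3 ?A])
    fix i :: nat assume "i < 3"
    then consider "i = 0" | "i = 1" | "i = 2" by linarith
    then show "\<exists>f. regular f \<and> (\<forall>(u, v)\<in>?A i. f (act (lin u v) T) = 0) \<and>
       (\<exists>(u, v)\<in>?A (Suc i). f (act (lin u v) T) \<noteq> 0)"
    proof cases
      case 1
      then show ?thesis using g
        by (intro exI[of _ "\<lambda>S. g S - g T"]) (auto intro: regular_intros simp: act_id)
    qed (use separate_top separate_borel in \<open>simp_all\<close>)
  qed (use affine_parts affine_part_GL GL_nonempty flag_mem in auto)
qed

lemma orbit_dim_ge_4:
  assumes f: "regular f" "\<And>u v. (u, v) \<in> torus_part \<Longrightarrow> f (act (lin u v) T) = 0"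
       "(u, v) \<in> mirabolic_part" "f (act (lin u v) T) \<noteq> 0"
    and g: "regular g" "(u', v') \<in> torus_part" "g (act (lin u' v') T) \<noteq> g T"
  shows "enat 4 \<le> orbit_dim T"
proof -
  let ?A = "\<lambda>i::nat. if i = 0 then {(e1, e2)} else if i = 1 then torus_part else if i = 2 then mirabolic_part
     else if i = 3 then borel_part else {w. wdet w \<noteq> 0}"
  show ?thesis
  proof (rule orbit_dim_ge[OF T, of 4 ?A])
    fix i :: nat assume "i < 4"
    then consider "i = 0" | "i = 1" | "i = 2" | "i = 3" by linarith
    then show "\<exists>f. regular f \<and> (\<forall>(u, v)\<in>?A i. f (act (lin u v) T) = 0) \<and>
       (\<exists>(u, v)\<in>?A (Suc i). f (act (lin u v) T) \<noteq> 0)"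
    proof cases
      case 1
      then show ?thesis using g
        by (intro exI[of _ "\<lambda>S. g S - g T"]) (auto intro: regular_intros simp: act_id)
    next
      case 2
      then show ?thesis using f by (intro exI[of _ f]) auto
    qed (use separate_top separate_borel in \<open>simp_all\<close>)
  qed (use affine_parts affine_part_GL GL_nonempty flag_mem in auto)
qed

end

lemma trace_linear:
  assumes "T \<in> Bil2"
  shows "trL (fst T) x = x $ 1 * trL (fst T) e1 + x $ 2 * trL (fst T) e2"
    "trL (snd T) x = x $ 1 * trL (snd T) e1 + x $ 2 * trL (snd T) e2"
    "trR (snd T) x = x $ 1 * trR (snd T) e1 + x $ 2 * trR (snd T) e2"
proof -
  have T: "fst T = bil (fst T e1 e1) (fst T e1 e2) (fst T e2 e1) (fst T e2 e2)"
    "snd T = bil (snd T e1 e1) (snd T e1 e2) (snd T e2 e1) (snd T e2 e2)"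
    using assms cbilinear_eq_bil by (auto simp: Bil2_def)
  have 1: "trace2 (\<lambda>y. bil a b c d x y) = x $ 1 * trace2 (\<lambda>y. bil a b c d e1 y) + x $ 2 * trace2 (\<lambda>y. bil a b c d e2 y)"
    and 2: "trace2 (\<lambda>y. bil a b c d y x) = x $ 1 * trace2 (\<lambda>y. bil a b c d y e1) + x $ 2 * trace2 (\<lambda>y. bil a b c d y e2)"
    for a b c d by (simp_all add: trace2_def bil_nth e_nth algebra_simps)
  show "trL (fst T) x = x $ 1 * trL (fst T) e1 + x $ 2 * trL (fst T) e2"
    by (subst (1 2 3) T(1)) (rule 1)
  show "trL (snd T) x = x $ 1 * trL (snd T) e1 + x $ 2 * trL (snd T) e2"
    by (subst (1 2 3) T(2)) (rule 1)
  show "trR (snd T) x = x $ 1 * trR (snd T) e1 + x $ 2 * trR (snd T) e2"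
    by (subst (1 2 3) T(2)) (rule 2)
qed

lemma covariant_traces:
  assumes "T \<in> Bil2"
  shows "trL (fst T) e2 = 0 \<Longrightarrow> trL (fst T) e1 \<noteq> 0 \<Longrightarrow> covariant_form (\<lambda>S. trL (fst S)) T"
    "trL (snd T) e2 = 0 \<Longrightarrow> trL (snd T) e1 \<noteq> 0 \<Longrightarrow> covariant_form (\<lambda>S. trL (snd S)) T"
    "trR (snd T) e2 = 0 \<Longrightarrow> trR (snd T) e1 \<noteq> 0 \<Longrightarrow> covariant_form (\<lambda>S. trR (snd S)) T"
proof -
  show "covariant_form (\<lambda>S. trL (fst S)) T" if "trL (fst T) e2 = 0" "trL (fst T) e1 \<noteq> 0"
  proof (rule covariant_form.intro[OF assms trace_act(1)[OF assms] _ _ that(2)])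
    show "trL (fst T) x = x $ 1 * trL (fst T) e1" for x
      using trace_linear(1)[OF assms, of x] that(1) by simp
  qed (assumption | intro regular_intros)+
  show "covariant_form (\<lambda>S. trL (snd S)) T" if "trL (snd T) e2 = 0" "trL (snd T) e1 \<noteq> 0"
  proof (rule covariant_form.intro[OF assms trace_act(2)[OF assms] _ _ that(2)])
    show "trL (snd T) x = x $ 1 * trL (snd T) e1" for x
      using trace_linear(2)[OF assms, of x] that(1) by simp
  qed (assumption | intro regular_intros)+
  show "covariant_form (\<lambda>S. trR (snd S)) T" if "trR (snd T) e2 = 0" "trR (snd T) e1 \<noteq> 0"
  proof (rule covariant_form.intro[OF assms trace_act(3)[OF assms] _ _ that(2)])
    show "trR (snd T) x = x $ 1 * trR (snd T) e1" for x
      using trace_linear(3)[OF assms, of x] that(1) by simp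
  qed (assumption | intro regular_intros)+
qed

lemma act_eval:
  "det2 u v \<noteq> 0 \<Longrightarrow> fst (act (lin u v) T) x y = lin u v (fst T (linv u v x) (linv u v y))"
  "det2 u v \<noteq> 0 \<Longrightarrow> snd (act (lin u v) T) x y = lin u v (snd T (linv u v x) (linv u v y))"
  by (simp_all add: act_lin)

lemmas coord_eval = act_eval lin_nth linv_nth adj_nth bil_nth e_nth det2_def

lemma torus_coord:
  assumes "(u, v) \<in> torus_part"
  shows "fst (act (lin u v) (bil a b c d, p)) e1 e1 $ 2 = a $ 2 * v $ 2"
    "snd (act (lin u v) (m, bil a b c d)) e1 e1 $ 2 = a $ 2 * v $ 2"
  using assms by (auto simp: torus_part_def coord_eval)

text \<open>Origin of the 3: for the shear by s this coordinate is -s (s - 1)(s - 2) on the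
  representative of \<open>C08\<close> and s (s - 1)(2 s - 1) on those of \<open>C07\<close> and
  \<open>C09\<close>, so s = 3 is the first positive integer that serves all of them.\<close>

lemma shear_coord:
  shows "fst (act (lin (e1 + 3 *s e2) e2) (bil a b c d, p)) e1 e1 $ 2 =
      (a - 3 *s b - 3 *s c + 9 *s d) $ 2 + 3 * (a - 3 *s b - 3 *s c + 9 *s d) $ 1"
    "snd (act (lin (e1 + 3 *s e2) e2) (m, bil a b c d)) e1 e1 $ 2 =
      (a - 3 *s b - 3 *s c + 9 *s d) $ 2 + 3 * (a - 3 *s b - 3 *s c + 9 *s d) $ 1"
  by (simp_all add: coord_eval)

text \<open>Representatives of the orbits on which a trace form vanishes on \<open>e2\<close>.\<close>
lemma base_points:
  "isomorphic (str C04) (bil 0 0 0 0, bil 0 e2 0 0)"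
  "isomorphic (str C07) (bil 0 0 0 0, bil e1 e1 e1 (2 *s e1 - e2))"
  "isomorphic (str C08) (bil 0 0 0 0, bil e1 (2 *s e2 - e1) (e2 - e1) (e2 - e1))"
  "isomorphic (str C09) (bil e1 e1 e1 (2 *s e1 - e2), bil 0 0 0 0)"
  "isomorphic (str (C15 \<gamma>)) (bil 0 0 0 e1, bil (2 *s e1) e2 0 ((- \<gamma> * \<gamma>) *s e1))"
  subgoal by (rule isomorphic_bil[OF str_Bil2, of e2 e1]) (simp_all add: chart_eval)
  subgoal by (rule isomorphic_bil[OF str_Bil2, of e1 "e1 - e2"]) (simp_all add: chart_eval)
  subgoal by (rule isomorphic_bil[OF str_Bil2, of e1 "e1 - 2 *s e2"]) (simp_all add: chart_eval)
  subgoal by (rule isomorphic_bil[OF str_Bil2, of e1 "e1 - e2"]) (simp_all add: chart_eval)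
  subgoal by (rule isomorphic_bil[OF str_Bil2, of e2 "e1 - \<gamma> *s e2"]) (simp_all add: chart_eval algebra_simps)
  done

text \<open>The coefficient of e1 \<circ> e1 at \<open>e2\<close> is only rescaled by the torus, so
  it stays 0 there, while the shear makes it nonzero. This separates torus and mirabolic group; g
  separates identity and torus.\<close>

lemma orbit_dim_ge_4_snd:
  fixes a b c d m1 m2 m3 m4 :: V
  defines "T \<equiv> (bil m1 m2 m3 m4, bil a b c d)"
  assumes "covariant_form \<tau> T" and "a $ 2 = 0" "(a - 3 *s b - 3 *s c + 9 *s d) $ 2 + 3 * (a - 3 *s b - 3 *s c + 9 *s d) $ 1 \<noteq> 0"
    and g: "regular g" "g (act (lin e1 (2 *s e2)) T) \<noteq> g T"
  shows "enat 4 \<le> orbit_dim T"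
  by (rule covariant_form.orbit_dim_ge_4[OF assms(2), of "\<lambda>S. snd S e1 e1 $ 2", OF _ _ flag_mem(2) _ g(1) flag_mem(3) g(2)])
     (use assms(3,4) in \<open>auto simp: T_def torus_coord shear_coord intro: regular_coord\<close>)

lemma orbit_dim_ge_4_fst:
  fixes a b c d p1 p2 p3 p4 :: V
  defines "T \<equiv> (bil a b c d, bil p1 p2 p3 p4)"
  assumes "covariant_form \<tau> T" and "a $ 2 = 0" "(a - 3 *s b - 3 *s c + 9 *s d) $ 2 + 3 * (a - 3 *s b - 3 *s c + 9 *s d) $ 1 \<noteq> 0"
    and g: "regular g" "g (act (lin e1 (2 *s e2)) T) \<noteq> g T"
  shows "enat 4 \<le> orbit_dim T"
  by (rule covariant_form.orbit_dim_ge_4[OF assms(2), of "\<lambda>S. fst S e1 e1 $ 2", OF _ _ flag_mem(2) _ g(1) flag_mem(3) g(2)])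
     (use assms(3,4) in \<open>auto simp: T_def torus_coord shear_coord intro: regular_coord\<close>)

lemmas covariant_bil = covariant_traces[OF bil_Bil2]

lemmas tr_eval = trace2_def bil_nth e_nth

section \<open>Exact dimensions\<close>

lemma orbit_dim_4:
  assumes "T \<in> {C07, C08, C09, C11, C13, C14, C15 \<gamma>, C16}"
  shows "orbit_dim (str T) = 4"
proof -
  note iso = base_points[THEN orbit_dim_cong]
  have "enat 4 \<le> orbit_dim (str C07)" unfolding iso
    by (rule orbit_dim_ge_4_snd[OF covariant_bil(3) _ _ regular_coord(2)[of 1 2 1]])
       (simp_all add: tr_eval coord_eval)
  moreover have "enat 4 \<le> orbit_dim (str C08)" unfolding iso
    by (rule orbit_dim_ge_4_snd[OF covariant_bil(3) _ _ regular_coord(2)[of 1 2 1]])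
       (simp_all add: tr_eval coord_eval)
  moreover have "enat 4 \<le> orbit_dim (str C09)" unfolding iso
    by (rule orbit_dim_ge_4_fst[OF covariant_bil(1) _ _ regular_coord(1)[of 1 2 1]])
       (simp_all add: tr_eval coord_eval)
  moreover have "enat 4 \<le> orbit_dim (str C11)" unfolding str.simps
    by (rule orbit_dim_ge_4_fst[OF covariant_bil(1) _ _ regular_coord(2)[of 2 2 2]])
       (simp_all add: tr_eval coord_eval)
  moreover have "enat 4 \<le> orbit_dim (str C13)" unfolding str.simps
    by (rule orbit_dim_ge_4_fst[OF covariant_bil(1) _ _ regular_coord(2)[of 2 2 2]])
       (simp_all add: tr_eval coord_eval)
  moreover have "enat 4 \<le> orbit_dim (str C14)" unfolding str.simps
    by (rule orbit_dim_ge_4_snd[OF covariant_bil(3) _ _ regular_coord(1)[of 1 1 2]])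
       (simp_all add: tr_eval coord_eval)
  \<comment> \<open>The second product would give 3 - 27 \<gamma>^2 in the shear condition, which
    can vanish. The first product gives 27.\<close>
  moreover have "enat 4 \<le> orbit_dim (str (C15 \<gamma>))" unfolding iso
    by (rule orbit_dim_ge_4_fst[OF covariant_bil(3) _ _ regular_coord(1)[of 2 2 1]])
       (simp_all add: tr_eval coord_eval)
  moreover have "enat 4 \<le> orbit_dim (str C16)" unfolding str.simps
    by (rule orbit_dim_ge_4_snd[OF covariant_bil(3) _ _ regular_coord(1)[of 1 1 2]])
       (simp_all add: tr_eval coord_eval)
  ultimately have "enat 4 \<le> orbit_dim (str T)" using assms by blast
  with orbit_dim_le_4[OF str_Bil2, of T] show ?thesis by (simp add: numeral_eq_enat)
qed

lemma orbit_dim_3: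
  assumes "T \<in> {C01, C02, C04, C10 \<alpha>, C12 \<alpha>} \<or> T = C05 \<alpha> \<and> \<alpha> \<noteq> 1 \<or> T = C06 \<alpha> \<and> \<alpha> \<noteq> 0"
  shows "orbit_dim (str T) = 3"
proof -
  note ge = covariant_form.orbit_dim_ge_3
  have shear: "(e1 + 3 *s e2, e2) \<in> mirabolic_part" and scale: "(e1, 2 *s e2) \<in> mirabolic_part"
    using flag_mem by auto
  \<comment> \<open>Shears fix \<open>C01\<close> and \<open>C02\<close>, so the scaling of
    \<open>e2\<close> has to separate. The remaining representatives are fixed by that scaling and
    are separated by the shear.\<close>
  have "enat 3 \<le> orbit_dim (str C01)" unfolding str.simps
    by (rule ge[OF covariant_bil(3) regular_coord(2)[of 1 1 2] scale]) (simp_all add: tr_eval coord_eval)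
  moreover have "enat 3 \<le> orbit_dim (str C02)" unfolding str.simps
    by (rule ge[OF covariant_bil(3) regular_coord(2)[of 1 1 2] scale]) (simp_all add: tr_eval coord_eval)
  moreover have "enat 3 \<le> orbit_dim (str C04)" unfolding base_points(1)[THEN orbit_dim_cong]
    by (rule ge[OF covariant_bil(2) regular_coord(2)[of 1 1 2] shear]) (simp_all add: tr_eval coord_eval)
  moreover have "enat 3 \<le> orbit_dim (str (C10 \<alpha>))" unfolding str.simps
    by (rule ge[OF covariant_bil(1) regular_coord(1)[of 1 1 2] shear]) (simp_all add: tr_eval coord_eval)
  moreover have "enat 3 \<le> orbit_dim (str (C12 \<alpha>))" unfolding str.simps
    by (rule ge[OF covariant_bil(1) regular_coord(1)[of 1 1 2] shear]) (simp_all add: tr_eval coord_eval)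
  \<comment> \<open>The shear changes the coordinate from 0 to 3 (1 - \<alpha>) on
    \<open>C05 \<alpha>\<close>, and to - 3 \<alpha> on \<open>C06 \<alpha>\<close>; hence the
    excluded parameters.\<close>
  moreover have "enat 3 \<le> orbit_dim (str (C05 \<alpha>))" if "\<alpha> \<noteq> 1" using that unfolding str.simps
    by (intro ge[OF covariant_bil(3) regular_coord(2)[of 1 1 2] shear]) (simp_all add: tr_eval coord_eval)
  moreover have "enat 3 \<le> orbit_dim (str (C06 \<alpha>))" if "\<alpha> \<noteq> 0" using that unfolding str.simps
    by (intro ge[OF covariant_bil(3) regular_coord(2)[of 1 1 2] shear]) (simp_all add: tr_eval coord_eval)
  ultimately have "enat 3 \<le> orbit_dim (str T)" using assms by blast
  moreover have "orbit_dim (str T) \<le> enat 3" using assms by (intro orbit_dim_le_3[of T \<alpha>]) auto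
  ultimately show ?thesis by (simp add: numeral_eq_enat)
qed

lemma orbit_dim_2:
  assumes "T \<in> {C03, C05 1, C06 0, C17 \<beta>}"
  shows "orbit_dim (str T) = 2"
proof -
  have scale: "(e1, 2 *s e2) \<in> borel_part" using flag_mem by auto
  have "enat 2 \<le> orbit_dim (str C03)" unfolding str.simps
    by (rule orbit_dim_ge_flag2[OF bil_Bil2 regular_coord(2)[of 2 2 1] _ entry_witness(1)[simplified] _ regular_coord(2)[of 1 1 2] scale])
       (auto simp: coord_eval borel_part_def)
  moreover have "enat 2 \<le> orbit_dim (str (C17 \<beta>))" unfolding str.simps
    by (rule orbit_dim_ge_flag2[OF bil_Bil2 regular_coord(1)[of 2 2 1] _ entry_witness(1)[simplified] _ regular_coord(1)[of 1 1 2] scale])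
       (auto simp: coord_eval borel_part_def)
  moreover have "enat 2 \<le> orbit_dim (str (C05 1))" unfolding str.simps
    by (rule covariant_form.orbit_dim_ge_2[OF covariant_bil(3)]) (simp_all add: tr_eval)
  moreover have "enat 2 \<le> orbit_dim (str (C06 0))" unfolding str.simps
    by (rule covariant_form.orbit_dim_ge_2[OF covariant_bil(3)]) (simp_all add: tr_eval)
  ultimately have "enat 2 \<le> orbit_dim (str T)" using assms by blast
  with orbit_dim_le_2[OF assms] show ?thesis by (simp add: numeral_eq_enat)
qed

text \<open>The orbit is a single point, so there is no strict inclusion between nonempty
  subsets.\<close>

lemma orbit_dim_Zero: "orbit_dim (str Zero) = 0"
proof -
  have z: "bil 0 0 0 0 = (\<lambda>x y. 0)" by (simp add: bil_def fun_eq_iff)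
  have "lin u v 0 = 0" for u v by (simp add: lin_def)
  then have "orbit (str Zero) \<subseteq> {str Zero}"
    by (auto simp: orbit_iff_isomorphic isomorphic_lin z fun_eq_iff) (metis lin_linv)+
  then have "orbit_dim (str Zero) \<le> 0"
    unfolding orbit_dim_def krull_dim_def
  proof (intro Sup_least, safe)
    fix n and Z :: "nat \<Rightarrow> bilpair set"
    let ?X = "subtopology zariski (orbit (str Zero))"
    assume Z: "\<forall>i\<le>n. closedin ?X (Z i) \<and> irreducible_in ?X (Z i)" "\<forall>i<n. Z i \<subset> Z (Suc i)"
      and sub: "orbit (str Zero) \<subseteq> {str Zero}"
    have "n = 0"
    proof (rule ccontr)
      assume "n \<noteq> 0"
      then have "Z 0 \<noteq> {}" "Z 0 \<subset> Z (Suc 0)" "Z (Suc 0) \<subseteq> orbit (str Zero)"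
        using Z by (auto simp: irreducible_in_def)
      with sub show False by blast
    qed
    then show "enat n \<le> 0" by (simp add: zero_enat_def)
  qed
  then show ?thesis by simp
qed

section \<open>The degeneration order\<close>

text \<open>Replacing \<open>e1\<close> by its negative preserves e1 \<cdot> e1 = e2 and reverses
  the sign of \<gamma>.\<close>

lemma isomorphic_C15: "isomorphic (str (C15 \<gamma>)) (str (C15 (- \<gamma>)))"
  unfolding str.simps(15)
  by (rule isomorphic_bil[OF bil_Bil2, of "- e1" e2]) (simp_all add: chart_eval)

lemma degenerates_reachable:
  assumes "degenerates (str T) (str T')"
  shows "isomorphic (str T) (str T') \<or> primary\<^sup>+\<^sup>+ T T'"
proof -
  have step: "primary\<^sup>+\<^sup>+ A B" if "primary A B" for A B using that by blast
  have two: "primary\<^sup>+\<^sup>+ A C" if "primary A B" "primary\<^sup>+\<^sup>+ B C" for A B C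
    using that by (rule tranclp_into_tranclp2)
  have C03: "primary\<^sup>+\<^sup>+ C03 Zero" and C17: "primary\<^sup>+\<^sup>+ (C17 \<beta>) Zero" for \<beta>
    by (intro step primary.intros)+
  have C05: "primary\<^sup>+\<^sup>+ (C05 \<alpha>) C03" "primary\<^sup>+\<^sup>+ (C05 \<alpha>) Zero" if "\<alpha> \<noteq> 1" for \<alpha>
    using that by (auto intro: step two C03 primary.intros)
  have C06: "primary\<^sup>+\<^sup>+ (C06 \<alpha>) C03" "primary\<^sup>+\<^sup>+ (C06 \<alpha>) Zero" if "\<alpha> \<noteq> 0" for \<alpha>
    using that by (auto intro: step two C03 primary.intros)
  have C10: "primary\<^sup>+\<^sup>+ (C10 \<alpha>) (C17 \<alpha>)" "primary\<^sup>+\<^sup>+ (C10 \<alpha>) Zero" for \<alpha>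
    by (auto intro: step two C17 primary.intros)
  \<comment> \<open>In the cases for these constructors the names \<open>C05\<close> and
    \<open>C06\<close> are taken over by the case assumptions.\<close>
  note C05_Zero = C05(2) and C06_Zero = C06(2)
  have refl: ?thesis if "T' = T" using that isomorphic_refl by simp
  show ?thesis
  proof (cases T)
    case C01
    then show ?thesis using degenerates_C01[of T'] assms refl C03 by (auto intro: step two primary.intros)
  next
    case C02
    then show ?thesis using degenerates_C02[of T'] assms refl C03 by (auto intro: step two primary.intros)
  next
    case C03
    then show ?thesis using degenerates_C03[of T'] assms refl by (auto intro: step two primary.intros)
  next
    case C04
    then show ?thesis using degenerates_C04[of T'] assms refl C03 by (auto intro: step two primary.intros)
  next
    case (C05 \<alpha>)
    then show ?thesis
      using degenerates_C05[of \<alpha> T'] degenerates_C05_1[of T'] assms refl C05_Zero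
      by (cases "\<alpha> = 1") (auto intro: step primary.intros)
  next
    case (C06 \<alpha>)
    then show ?thesis
      using degenerates_C06[of \<alpha> T'] degenerates_C06_0[of T'] assms refl C06_Zero
      by (cases "\<alpha> = 0") (auto intro: step primary.intros)
  next
    case C07
    then show ?thesis using degenerates_C07[of T'] assms refl C05[of 0]
      by (auto intro: step two primary.intros)
  next
    case C08
    then show ?thesis using degenerates_C08[of T'] assms refl C05[of "1/2"]
      by (auto intro: step two primary.intros)
  next
    case C09
    then show ?thesis using degenerates_C09[of T'] assms refl C10[of 0]
      by (auto intro: step two primary.intros)
  next
    case (C10 \<alpha>)
    then show ?thesis using degenerates_C10[of \<alpha> T'] assms refl
      by (auto intro: step two C17 primary.intros)
  next
    case C11
    then show ?thesis using degenerates_C11[of T'] assms refl C05[of 0]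
      by (auto intro: step two primary.intros)
  next
    case (C12 \<alpha>)
    then show ?thesis using degenerates_C12[of \<alpha> T'] assms refl
      by (auto intro: step two C17 primary.intros)
  next
    case C13
    then show ?thesis using degenerates_C13[of T'] assms refl C05[of 0]
      by (auto intro: step two primary.intros)
  next
    case C14
    then show ?thesis using degenerates_C14[of T'] assms refl C05[of 2]
      by (auto intro: step two primary.intros)
  next
    case (C15 \<gamma>)
    then show ?thesis using degenerates_C15[of \<gamma> T'] assms refl C05[of "1/2"] isomorphic_C15[of \<gamma>]
      by (auto intro: step two primary.intros simp del: str.simps)
  next
    case C16
    then show ?thesis using degenerates_C16[of T'] assms refl C06[of 2]
      by (auto intro: step two primary.intros)
  next
    case (C17 \<beta>)
    then show ?thesis using degenerates_C17[of \<beta> T'] assms refl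
      by (auto intro: step primary.intros)
  next
    case Zero
    then show ?thesis using degenerates_Zero[of T'] assms refl by auto
  qed
qed

lemma reachable_degenerates: "primary\<^sup>+\<^sup>+ T T' \<Longrightarrow> degenerates (str T) (str T')"
  by (induction rule: tranclp_induct) (auto intro: primary_degenerates degenerates_trans[OF _ _ str_Bil2 str_Bil2] simp del: str.simps)

theorem theorem50:
  shows "(\<forall>\<gamma>. \<forall>T \<in> {C07, C08, C09, C11, C13, C14, C15 \<gamma>, C16}. orbit_dim (str T) = 4)
       \<and> (\<forall>T \<in> {C01, C02, C04}. orbit_dim (str T) = 3)
       \<and> (\<forall>\<alpha>. \<alpha> \<noteq> 1 \<longrightarrow> orbit_dim (str (C05 \<alpha>)) = 3)
       \<and> (\<forall>\<alpha>. \<alpha> \<noteq> 0 \<longrightarrow> orbit_dim (str (C06 \<alpha>)) = 3)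
       \<and> (\<forall>\<alpha>. orbit_dim (str (C10 \<alpha>)) = 3)
       \<and> (\<forall>\<alpha>. orbit_dim (str (C12 \<alpha>)) = 3)
       \<and> (\<forall>\<beta>. \<forall>T \<in> {C03, C05 1, C06 0, C17 \<beta>}. orbit_dim (str T) = 2)
       \<and> orbit_dim (str Zero) = 0
       \<and> (\<forall>T T'. degenerates (str T) (str T') \<longleftrightarrow>
            isomorphic (str T) (str T') \<or> primary\<^sup>+\<^sup>+ T T')"
proof (intro conjI allI impI ballI)
  fix T T'
  show "degenerates (str T) (str T') \<longleftrightarrow> isomorphic (str T) (str T') \<or> primary\<^sup>+\<^sup>+ T T'"
    using degenerates_reachable reachable_degenerates degenerates_isomorphic[OF str_Bil2] by blast
qed (blast intro: orbit_dim_4 orbit_dim_3 orbit_dim_2 orbit_dim_Zero)+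

end
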